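(* Let $p\ge 1$ be an integer and let $f:\mathbb{R}^d\to\mathbb{R}$ be a convex function whose $p$-th derivative is $L_p$-Lipschitz, and let $x^*$ denote a minimizer of $f$. Set $c_p = \frac{2^{p-1}(p+1)^{\frac{3p+1}{2}}}{(p-1)!}$. (1) Accelerated Taylor Descent (ATD), as defined in the context, satisfies, for every $k\ge 1$ (for every run of ATD that produces $y_k$), $$f(y_k)-f(x^* )\le \frac{c_p\cdot L_p\cdot\|x^*\|^{p+1}}{k^{\frac{3p+1}{2}}}.$$ (2) Each iteration of ATD can be implemented with few calls to a $p$-th order Taylor expansion oracle in the following sense. Given a precision $\epsilon>0$, at each iteration $k$ (the iteration of ATD whose role is to produce $y_k$ from the previously computed quantities), using at most $$30p\log_2 p+\log_2\left\lceil\frac{L_p\|x^*\|^{p+1}}{\epsilon}\right\rceil$$ calls to the $p$-th order Taylor expansion oracle one finds either a point $y$ such that $f(y)-f(x^* )\le\epsilon$, or one finds $y_k$ (i.e. a pair $(\lambda_k,y_k)$ satisfying the requirements of the ATD iteration).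
   Context: $\|\cdot\|$ is the Euclidean norm on $\mathbb{R}^d$; $L_p>0$, and "the $p$-th derivative is $L_p$-Lipschitz" means that $f$ is $p$ times differentiable and $\|\nabla^p f(x)-\nabla^p f(y)\|\le L_p\|x-y\|$ for all $x,y$ (operator norm of symmetric $p$-linear forms). The $p$-th order Taylor expansion of $f$ at $x$ is $f_p(y,x)=f(x)+\sum_{i=1}^p\frac{1}{i!}\nabla^i f(x)[y-x]^i$. A $p$-th order Taylor expansion oracle, given a query point $x$, returns the polynomial $f_p(\cdot,x)$. Only oracle calls are counted; other computations (in particular exact minimization of the regularized Taylor polynomial below) are free. Accelerated Taylor Descent (ATD): set $A_0=0$, $x_0=y_0=0\in\mathbb{R}^d$. For $k=0,1,2,\dots$, compute a pair $\lambda_{k+1}>0$, $y_{k+1}\in\mathbb{R}^d$ such that $$\frac12\le\lambda_{k+1}\frac{L_p\|y_{k+1}-\tilde x_k\|^{p-1}}{(p-1)!}\le\frac{p}{p+1},\qquad y_{k+1}=\arg\min_{y\in\mathbb{R}^d}\Big\{f_p(y,\tilde x_k)+\frac{L_p}{p!}\|y-\tilde x_k\|^{p+1}\Big\},$$ where $$a_{k+1}=\frac{\lambda_{k+1}+\sqrt{\lambda_{k+1}^2+4\lambda_{k+1}A_k}}{2},\quad A_{k+1}=A_k+a_{k+1},\quad \tilde x_k=\frac{A_k}{A_{k+1}}y_k+\frac{a_{k+1}}{A_{k+1}}x_k$$ (so $\tilde x_k$, and hence $y_{k+1}$, depends on $\lambda_{k+1}$; the pair is chosen simultaneously). Then set $x_{k+1}=x_k-a_{k+1}\nabla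 f(y_{k+1})$. *)

theory Defs
  imports "HOL-Analysis.Analysis"
begin

section \<open>Higher derivatives and Taylor expansions\<close>

(* nabla f [v1, ..., vi] x is the i-linear form D^i f(x) evaluated at (v1, ..., vi), obtained by
   iterating the Frechet derivative: D^(i+1) f(x)[v, v1, ..., vi] is the derivative at x, in
   direction v, of z |-> D^i f(z)[v1, ..., vi].  It is meaningful for times_differentiable
   functions, i being at most the order of differentiability. *)
primrec nabla :: "('a::euclidean_space \<Rightarrow> real) \<Rightarrow> 'a list \<Rightarrow> 'a \<Rightarrow> real" where
  "nabla f [] = f"
| "nabla f (v # vs) = (\<lambda>x. frechet_derivative (nabla f vs) (at x) v)"

(* The space of i-linear forms is finite-dimensional, so x |-> D^i f(x) is (totally)
   differentiable iff each of its evaluations x |-> D^i f(x)[v1, ..., vi] is. *)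
definition times_differentiable :: "nat \<Rightarrow> ('a::euclidean_space \<Rightarrow> real) \<Rightarrow> bool" where
  "times_differentiable p f \<longleftrightarrow>
     (\<forall>vs x. length vs < p \<longrightarrow> nabla f vs differentiable (at x))"

(* Operator norm of a p-linear form. *)
definition form_norm :: "nat \<Rightarrow> ('a::euclidean_space list \<Rightarrow> real) \<Rightarrow> real" where
  "form_norm p T = (SUP vs \<in> {vs. length vs = p \<and> (\<forall>v\<in>set vs. norm v \<le> 1)}. \<bar>T vs\<bar>)"

definition lipschitz_derivative ::
  "nat \<Rightarrow> real \<Rightarrow> ('a::euclidean_space \<Rightarrow> real) \<Rightarrow> bool" where
  "lipschitz_derivative p L f \<longleftrightarrow>
     times_differentiable p f \<and>
     (\<forall>x y. form_norm p (\<lambda>vs. nabla f vs x - nabla f vs y) \<le> L * norm (x - y))"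

(* taylor p f x is the polynomial f_p(., x); the expansion point x comes first. *)
definition taylor :: "nat \<Rightarrow> ('a::euclidean_space \<Rightarrow> real) \<Rightarrow> 'a \<Rightarrow> 'a \<Rightarrow> real" where
  "taylor p f x y = f x + (\<Sum>i=1..p. 1 / fact i * nabla f (replicate i (y - x)) x)"

section \<open>Accelerated Taylor Descent\<close>

definition step_size :: "real \<Rightarrow> real \<Rightarrow> real" where
  "step_size lam A = (lam + sqrt (lam\<^sup>2 + 4 * lam * A)) / 2"

definition extrapolation ::
  "real \<Rightarrow> 'a::euclidean_space \<Rightarrow> 'a \<Rightarrow> real \<Rightarrow> 'a" where
  "extrapolation A x y lam =
     (let a = step_size lam A; A' = A + a in (A / A') *\<^sub>R y + (a / A') *\<^sub>R x)"

(* (lam', y') is an admissible choice of (lambda_{k+1}, y_{k+1}) when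
   A, x, y are A_k, x_k, y_k. *)
definition atd_pair ::
  "nat \<Rightarrow> real \<Rightarrow> ('a::euclidean_space \<Rightarrow> real) \<Rightarrow> real \<Rightarrow> 'a \<Rightarrow> 'a \<Rightarrow> real \<Rightarrow> 'a \<Rightarrow> bool" where
  "atd_pair p L f A x y lam' y' \<longleftrightarrow>
     (let xt = extrapolation A x y lam' in
        0 < lam' \<and>
        1 / 2 \<le> lam' * (L * norm (y' - xt) ^ (p - 1) / fact (p - 1)) \<and>
        lam' * (L * norm (y' - xt) ^ (p - 1) / fact (p - 1)) \<le> real p / (real p + 1) \<and>
        is_arg_min (\<lambda>z. taylor p f xt z + L / fact p * norm (z - xt) ^ (p + 1))
          (\<lambda>_. True) y')"

(* atd p L f k A x y: some run of ATD performs k iterations and arrives at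
   A_k = A, x_k = x, y_k = y. *)
inductive atd ::
  "nat \<Rightarrow> real \<Rightarrow> ('a::euclidean_space \<Rightarrow> real) \<Rightarrow> nat \<Rightarrow> real \<Rightarrow> 'a \<Rightarrow> 'a \<Rightarrow> bool"
  for p :: nat and L :: real and f :: "'a \<Rightarrow> real" where
  init: "atd p L f 0 0 0 0"
| step: "\<lbrakk> atd p L f k A x y; atd_pair p L f A x y lam' y'; a' = step_size lam' A;
          GDERIV f y' :> g \<rbrakk>
         \<Longrightarrow> atd p L f (Suc k) (A + a') (x - a' *\<^sub>R g) y'"

definition atd_const :: "nat \<Rightarrow> real" where
  "atd_const p = 2 ^ (p - 1) * (real p + 1) powr ((3 * real p + 1) / 2) / fact (p - 1)"

section \<open>Query complexity\<close>

(* Deterministic adaptive procedures asking queries of type 'q with answers of type 'r: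
   everything between two queries is free, so a procedure is just its decision tree. *)
datatype ('q, 'r, 'o) procedure =
    Return 'o
  | Query 'q "'r \<Rightarrow> ('q, 'r, 'o) procedure"

primrec result :: "('q \<Rightarrow> 'r) \<Rightarrow> ('q, 'r, 'o) procedure \<Rightarrow> 'o" where
  "result answer (Return u) = u"
| "result answer (Query q cont) = result answer (cont (answer q))"

primrec calls :: "('q \<Rightarrow> 'r) \<Rightarrow> ('q, 'r, 'o) procedure \<Rightarrow> nat" where
  "calls answer (Return u) = 0"
| "calls answer (Query q cont) = Suc (calls answer (cont (answer q)))"

datatype 'a outcome =
    Approx 'a          (* an approximate minimizer *)
  | Iterate real 'a    (* the pair (lambda_k, y_k) *)

(* The procedure has access to f only through the answers taylor p f x, that is,
   the Taylor polynomials f_p(., x) at the points x it queries. *)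
type_synonym 'a taylor_procedure = "('a, 'a \<Rightarrow> real, 'a outcome) procedure"

end

theory Submission
  imports Defs
begin

text \<open>
  Write \<open>r\<close> for the distance between \<open>y\<^sub>k\<^sub>+\<^sub>1\<close> and the extrapolated point and \<open>\<eta> = \<lambda> L r\<^sup>p\<^sup>-\<^sup>1 / (p-1)!\<close>. Optimality in
  the regularised Taylor model and the Taylor bound for the gradient say that \<open>y\<^sub>k\<^sub>+\<^sub>1\<close> is an inexact
  proximal step of length \<open>\<lambda>\<close> with relative error \<open>1 - \<eta>\<close>, as soon as \<open>\<eta> \<le> p/(p+1)\<close>. Hence the
  Monteiro--Svaiter potential \<open>A (f y - f x*) + |x - x*|\<^sup>2 / 2\<close> does not increase, and for \<open>\<eta> \<ge> 1/2\<close> it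
  loses \<open>3/8 A r\<^sup>2/\<lambda>\<close>. Balancing this loss against \<open>sqrt A\<^sub>k\<^sub>+\<^sub>1 \<ge> sqrt A\<^sub>k + sqrt \<lambda> / 2\<close> gives the growth
  of \<open>A\<^sub>k\<close>, and \<open>f y\<^sub>k - f x* \<le> |x*|\<^sup>2 / (2 A\<^sub>k)\<close>.

  For the query bound let \<open>\<lambda>\<^sub>0 = |x*|\<^sup>2 / (2 \<epsilon>)\<close>. If \<open>\<eta>(\<lambda>\<^sub>0) \<le> p/(p+1)\<close>, the potential already shows that
  the new point is \<open>\<epsilon>\<close>-optimal. Otherwise bisect \<open>[0, \<lambda>\<^sub>0]\<close>, linearly in \<open>\<lambda>\<close>, for a value with
  \<open>1/2 \<le> \<eta> \<le> p/(p+1)\<close>: the function \<open>\<eta>\<close> is Lipschitz on this interval with a constant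
  \<open>C\<^sub>p L |x*|\<^sup>p\<^sup>-\<^sup>1\<close>, so the number of halvings is the logarithm of \<open>L |x*|\<^sup>p\<^sup>+\<^sup>1/\<epsilon>\<close> plus a constant depending
  on \<open>p\<close> only. For \<open>p = 1\<close> the step length is forced and one call suffices.
\<close>

section \<open>Higher derivatives\<close>

text \<open>Schwarz's theorem under mere differentiability of the first derivative: the second difference of
  \<open>g\<close> is symmetric in \<open>v\<close> and \<open>w\<close>, and by the mean value theorem its leading term is \<open>t\<^sup>2 * E w\<close>.\<close>

lemma second_difference_approx:
  fixes g :: "'a::euclidean_space \<Rightarrow> real"
  assumes D: "\<And>x. (g has_derivative D x) (at x)"
    and E: "((\<lambda>x. D x v) has_derivative E) (at a)"
    and "e > 0"
  shows "eventually (\<lambda>t. \<bar>(g (a + t *\<^sub>R v + t *\<^sub>R w) - g (a + t *\<^sub>R v) - g (a + t *\<^sub>R w) + g a) - t\<^sup>2 * E w\<bar>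
             \<le> t\<^sup>2 * (e * (2 * (norm v + norm w)))) (at_right 0)"
proof -
  obtain d where "d > 0" and d: "\<And>y. norm (y - a) < d \<Longrightarrow> norm (D y v - D a v - E (y - a)) \<le> e * norm (y - a)"
    using E \<open>e > 0\<close> unfolding has_derivative_at_alt by blast
  interpret E: bounded_linear E using E by (rule has_derivative_bounded_linear)
  define d' where "d' = d / (norm v + norm w + 1)"
  have "d' > 0" using \<open>d > 0\<close> by (auto simp: d'_def intro!: divide_pos_pos add_nonneg_pos)
  have "\<bar>(g (a + t *\<^sub>R v + t *\<^sub>R w) - g (a + t *\<^sub>R v) - g (a + t *\<^sub>R w) + g a) - t\<^sup>2 * E w\<bar>
             \<le> t\<^sup>2 * (e * (2 * (norm v + norm w)))" if t: "0 < t" "t < d'" for t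
  proof -
    \<comment> \<open>\<open>\<phi> t - \<phi> 0\<close> is the second difference, so one use of the
      mean value theorem suffices: both resulting values of \<open>D _ v\<close> are then linearised
      at \<open>a\<close>.\<close>
    define \<phi> where "\<phi> s = g (a + s *\<^sub>R v + t *\<^sub>R w) - g (a + s *\<^sub>R v)" for s
    have der: "(\<phi> has_real_derivative D (a + s *\<^sub>R v + t *\<^sub>R w) v - D (a + s *\<^sub>R v) v) (at s)" for s
    proof -
      have "((\<lambda>s. g (a + s *\<^sub>R v + t *\<^sub>R w)) has_derivative (\<lambda>h. D (a + s *\<^sub>R v + t *\<^sub>R w) (h *\<^sub>R v))) (at s)"
        "((\<lambda>s. g (a + s *\<^sub>R v)) has_derivative (\<lambda>h. D (a + s *\<^sub>R v) (h *\<^sub>R v))) (at s)"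
        by (auto intro!: derivative_eq_intros has_derivative_compose[OF _ D])
      then have "(\<phi> has_derivative (\<lambda>h. D (a + s *\<^sub>R v + t *\<^sub>R w) (h *\<^sub>R v) - D (a + s *\<^sub>R v) (h *\<^sub>R v))) (at s)"
        unfolding \<phi>_def by (rule has_derivative_diff)
      moreover have "D x (h *\<^sub>R v) = D x v * h" for x h
        using linear_scale[OF has_derivative_linear[OF D]] by simp
      ultimately show ?thesis
        by (simp add: has_field_derivative_def left_diff_distrib[symmetric])
    qed
    obtain \<xi> where \<xi>: "0 < \<xi>" "\<xi> < t" and mvt: "\<phi> t - \<phi> 0 = (t - 0) * (D (a + \<xi> *\<^sub>R v + t *\<^sub>R w) v - D (a + \<xi> *\<^sub>R v) v)"
      using MVT2[of 0 t \<phi> "\<lambda>s. D (a + s *\<^sub>R v + t *\<^sub>R w) v - D (a + s *\<^sub>R v) v"] der t by blast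
    have "t * (norm v + norm w + 1) < d"
      using t by (simp add: d'_def pos_less_divide_eq add_nonneg_pos)
    then have td: "t * (norm v + norm w) < d" using t by (simp add: algebra_simps)
    have n1: "norm (\<xi> *\<^sub>R v + t *\<^sub>R w) \<le> t * (norm v + norm w)"
    proof -
      have "norm (\<xi> *\<^sub>R v + t *\<^sub>R w) \<le> \<xi> * norm v + t * norm w"
        using norm_triangle_ineq[of "\<xi> *\<^sub>R v" "t *\<^sub>R w"] \<xi> t by simp
      also have "\<dots> \<le> t * norm v + t * norm w" using \<xi> by (simp add: mult_right_mono)
      finally show ?thesis by (simp add: algebra_simps)
    qed
    have n2: "norm (\<xi> *\<^sub>R v) \<le> t * (norm v + norm w)"
      using \<xi> t by (simp add: distrib_left add_increasing2 mult_right_mono)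
    have b1: "\<bar>D (a + \<xi> *\<^sub>R v + t *\<^sub>R w) v - D a v - E (\<xi> *\<^sub>R v + t *\<^sub>R w)\<bar> \<le> e * (t * (norm v + norm w))"
    proof -
      have "\<bar>D (a + (\<xi> *\<^sub>R v + t *\<^sub>R w)) v - D a v - E (\<xi> *\<^sub>R v + t *\<^sub>R w)\<bar> \<le> e * norm (\<xi> *\<^sub>R v + t *\<^sub>R w)"
        using d[of "a + (\<xi> *\<^sub>R v + t *\<^sub>R w)"] n1 td by simp
      also have "\<dots> \<le> e * (t * (norm v + norm w))" using n1 \<open>e > 0\<close> by simp
      finally show ?thesis by (simp add: add.assoc)
    qed
    have b2: "\<bar>D (a + \<xi> *\<^sub>R v) v - D a v - E (\<xi> *\<^sub>R v)\<bar> \<le> e * (t * (norm v + norm w))"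
    proof -
      have "\<bar>D (a + \<xi> *\<^sub>R v) v - D a v - E (\<xi> *\<^sub>R v)\<bar> \<le> e * norm (\<xi> *\<^sub>R v)"
        using d[of "a + \<xi> *\<^sub>R v"] n2 td by simp
      also have "\<dots> \<le> e * (t * (norm v + norm w))" using n2 \<open>e > 0\<close> by (simp del: norm_scaleR)
      finally show ?thesis .
    qed
    have "\<bar>D (a + \<xi> *\<^sub>R v + t *\<^sub>R w) v - D (a + \<xi> *\<^sub>R v) v - t * E w\<bar> \<le> 2 * (e * (t * (norm v + norm w)))"
      using b1 b2 by (simp add: E.add E.scaleR)
    then have "t * \<bar>D (a + \<xi> *\<^sub>R v + t *\<^sub>R w) v - D (a + \<xi> *\<^sub>R v) v - t * E w\<bar>
        \<le> t * (2 * (e * (t * (norm v + norm w))))"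
      using t by simp
    moreover have "(g (a + t *\<^sub>R v + t *\<^sub>R w) - g (a + t *\<^sub>R v) - g (a + t *\<^sub>R w) + g a) - t\<^sup>2 * E w
        = t * (D (a + \<xi> *\<^sub>R v + t *\<^sub>R w) v - D (a + \<xi> *\<^sub>R v) v - t * E w)"
      using mvt by (simp add: \<phi>_def algebra_simps power2_eq_square)
    ultimately show ?thesis
      using t by (simp only: abs_mult power2_eq_square abs_of_pos) (simp add: mult_ac)
  qed
  then show ?thesis
    unfolding eventually_at_right_field using \<open>d' > 0\<close> by blast
qed

lemma second_derivative_symmetric:
  fixes g :: "'a::euclidean_space \<Rightarrow> real"
  assumes D: "\<And>x. (g has_derivative D x) (at x)"
    and E: "((\<lambda>x. D x v) has_derivative E) (at a)"
    and E': "((\<lambda>x. D x w) has_derivative E') (at a)"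
  shows "E w = E' v"
proof -
  have "\<bar>E w - E' v\<bar> \<le> c" if "c > 0" for c
  proof -
    \<comment> \<open>Each of the two approximations errs by
      \<open>e * 2 * (norm v + norm w)\<close>; the extra 1 in the denominator covers
      \<open>v = w = 0\<close>.\<close>
    define e where "e = c / (4 * (norm v + norm w + 1))"
    have e: "e > 0" using that by (auto simp: e_def intro!: divide_pos_pos add_nonneg_pos)
    have "eventually (\<lambda>t::real. 0 < t) (at_right 0)" by (simp add: eventually_at_right_less)
    with second_difference_approx[OF D E e, of w] second_difference_approx[OF D E' e, of v]
    have "eventually (\<lambda>t::real. \<bar>E w - E' v\<bar> \<le> c) (at_right 0)"
    proof eventually_elim
      case (elim t)
      have "\<bar>t\<^sup>2 * E w - t\<^sup>2 * E' v\<bar> \<le> t\<^sup>2 * (e * (4 * (norm v + norm w)))"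
        using elim(1,2) by (simp add: algebra_simps)
      then have "t\<^sup>2 * \<bar>E w - E' v\<bar> \<le> t\<^sup>2 * (e * (4 * (norm v + norm w)))"
        by (simp add: abs_mult right_diff_distrib[symmetric])
      then have "\<bar>E w - E' v\<bar> \<le> e * (4 * (norm v + norm w))" using elim(3) by simp
      also have "\<dots> \<le> e * (4 * (norm v + norm w + 1))" using e by simp
      also have "\<dots> = c"
        using norm_ge_zero[of v] norm_ge_zero[of w] by (simp add: e_def field_simps add_nonneg_eq_0_iff)
      finally show ?case .
    qed
    then show ?thesis by (simp add: trivial_limit_at_right_real eventually_const)
  qed
  then show ?thesis by (metis abs_le_zero_iff field_le_epsilon add_0 eq_iff_diff_eq_0)
qed

section \<open>Multilinearity, symmetry and boundedness of the derivatives\<close>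

lemma prod_list_norm_nonneg [simp]: "0 \<le> prod_list (map norm vs)"
  by (induction vs) auto

locale smooth_function =
  fixes p :: nat and f :: "'a::euclidean_space \<Rightarrow> real"
  assumes diff: "times_differentiable p f"
begin

lemma nabla_has_derivative:
  assumes "length vs < p"
  shows "(nabla f vs has_derivative (\<lambda>v. nabla f (v # vs) x)) (at x)"
  using diff assms by (simp add: times_differentiable_def flip: frechet_derivative_works)

lemma nabla_linear: "length vs < p \<Longrightarrow> linear (\<lambda>v. nabla f (v # vs) x)"
  using nabla_has_derivative has_derivative_linear by blast

lemma nabla_add: "length vs < p \<Longrightarrow> nabla f ((v + w) # vs) x = nabla f (v # vs) x + nabla f (w # vs) x"
  using linear_add[OF nabla_linear] by blast

lemma nabla_scale: "length vs < p \<Longrightarrow> nabla f ((c *\<^sub>R v) # vs) x = c * nabla f (v # vs) x"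
  using linear_scale[OF nabla_linear] by fastforce

lemma nabla_expand:
  assumes "length vs < p"
  shows "nabla f (v # vs) x = (\<Sum>b\<in>Basis. (v \<bullet> b) * nabla f (b # vs) x)"
proof -
  have "nabla f (v # vs) x = nabla f ((\<Sum>b\<in>Basis. (v \<bullet> b) *\<^sub>R b) # vs) x"
    by (simp only: euclidean_representation)
  also have "\<dots> = (\<Sum>b\<in>Basis. (v \<bullet> b) * nabla f (b # vs) x)"
    using linear_sum[OF nabla_linear[OF assms, of x], of "\<lambda>b. (v \<bullet> b) *\<^sub>R b" Basis] assms
    by (simp del: nabla.simps add: nabla_scale)
  finally show ?thesis .
qed

lemma nabla_swap:
  assumes "length vs + 2 \<le> p"
  shows "nabla f (v # w # vs) = nabla f (w # v # vs)"
proof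
  fix a
  have "length vs < p" "length (v # vs) < p" "length (w # vs) < p" using assms by auto
  note * = this[THEN nabla_has_derivative]
  have "nabla f (w # v # vs) a = nabla f (v # w # vs) a"
    by (rule second_derivative_symmetric[where E = "\<lambda>u. nabla f (u # v # vs) a" and v = v and a = a
          and D = "\<lambda>x v. nabla f (v # vs) x" and g = "nabla f vs" and w = w
          and E' = "\<lambda>u. nabla f (u # w # vs) a", OF *])
  then show "nabla f (v # w # vs) a = nabla f (w # v # vs) a" by simp
qed

text \<open>As an equation between functions of the base point, the induction hypothesis may be
  differentiated once more, in direction \<open>u\<close>; \<open>nabla_swap\<close> then exchanges
  the first two directions.\<close>

lemma nabla_move_front:
  "length us + length vs < p \<Longrightarrow> nabla f (us @ v # vs) = nabla f (v # us @ vs)"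
proof (induction us)
  case (Cons u us)
  then have "nabla f ((u # us) @ v # vs) = nabla f (u # v # us @ vs)"
    by (simp del: nabla.simps(2) add: nabla.simps(2)[of f u])
  also have "\<dots> = nabla f (v # u # us @ vs)"
    using Cons.prems by (intro nabla_swap) simp
  finally show ?case by simp
qed simp

lemma nabla_perm:
  "mset vs = mset ws \<Longrightarrow> length vs \<le> p \<Longrightarrow> nabla f vs = nabla f ws"
proof (induction vs arbitrary: ws)
  case (Cons v vs)
  then have "v \<in> set ws" by (metis list.set_intros(1) set_mset_mset)
  then obtain ws1 ws2 where ws: "ws = ws1 @ v # ws2" by (meson split_list)
  then have m: "mset vs = mset (ws1 @ ws2)" using Cons.prems by simp
  then have "length vs = length (ws1 @ ws2)" by (metis size_mset)
  then have "nabla f ws = nabla f (v # ws1 @ ws2)"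
    unfolding ws using Cons.prems by (intro nabla_move_front) simp
  then show ?case using Cons.IH[OF m] Cons.prems by simp
qed simp

lemma nabla_along_line:
  assumes "length vs < p"
  shows "((\<lambda>t. nabla f vs (x + t *\<^sub>R h)) has_real_derivative nabla f (h # vs) (x + t *\<^sub>R h)) (at t)"
proof -
  have "((\<lambda>t. nabla f vs (x + t *\<^sub>R h)) has_derivative (\<lambda>s. nabla f ((s *\<^sub>R h) # vs) (x + t *\<^sub>R h))) (at t)"
    by (rule has_derivative_compose[OF _ nabla_has_derivative[OF assms]]) (auto intro!: derivative_eq_intros)
  then show ?thesis
    using assms by (simp del: nabla.simps add: nabla_scale has_field_derivative_def mult.commute[of _ "nabla f _ _"])
qed

text \<open>Multilinear forms in finite dimension are bounded; this makes the supremum in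
  \<open>form_norm\<close> meaningful. The tail \<open>ws\<close> collects the basis vectors as the
  arguments are expanded one by one.\<close>

lemma nabla_bounded:
  "length ws + n \<le> p \<Longrightarrow> \<exists>B\<ge>0. \<forall>vs. length vs = n \<longrightarrow> \<bar>nabla f (vs @ ws) x\<bar> \<le> B * prod_list (map norm vs)"
proof (induction n arbitrary: ws)
  case 0
  then show ?case by (intro exI[of _ "\<bar>nabla f ws x\<bar>"]) auto
next
  case (Suc n)
  have "\<forall>b. \<exists>B\<ge>0. \<forall>vs. length vs = n \<longrightarrow> \<bar>nabla f (vs @ (b # ws)) x\<bar> \<le> B * prod_list (map norm vs)"
    using Suc.prems by (intro allI Suc.IH) simp
  then obtain B where B: "\<And>b. B b \<ge> 0"
    "\<And>b vs. length vs = n \<Longrightarrow> \<bar>nabla f (vs @ (b # ws)) x\<bar> \<le> B b * prod_list (map norm vs)" by metis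
  show ?case
  proof (intro exI[of _ "\<Sum>b\<in>Basis. B b"] conjI allI impI)
    fix us :: "'a list" assume "length us = Suc n"
    then obtain v vs where us: "us = v # vs" "length vs = n" by (metis length_Suc_conv)
    have eq: "nabla f (us @ ws) x = (\<Sum>b\<in>Basis. (v \<bullet> b) * nabla f (vs @ b # ws) x)"
    proof -
      have "nabla f (v # vs @ ws) x = (\<Sum>b\<in>Basis. (v \<bullet> b) * nabla f (b # vs @ ws) x)"
        using us Suc.prems by (intro nabla_expand) simp
      moreover have "nabla f (b # vs @ ws) = nabla f (vs @ b # ws)" for b
        using us Suc.prems by (intro nabla_move_front[symmetric]) simp
      ultimately show ?thesis using us by (simp del: nabla.simps)
    qed
    have "\<bar>nabla f (us @ ws) x\<bar> \<le> (\<Sum>b\<in>Basis. \<bar>v \<bullet> b\<bar> * \<bar>nabla f (vs @ b # ws) x\<bar>)"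
      unfolding eq by (rule order_trans[OF sum_abs]) (simp add: abs_mult)
    also have "\<dots> \<le> (\<Sum>b\<in>Basis. norm v * (B b * prod_list (map norm vs)))"
      using us by (intro sum_mono mult_mono Basis_le_norm B) auto
    also have "\<dots> = (\<Sum>b\<in>Basis. B b) * prod_list (map norm us)"
      using us by (simp add: sum_distrib_left sum_distrib_right mult_ac)
    finally show "\<bar>nabla f (us @ ws) x\<bar> \<le> (\<Sum>b\<in>Basis. B b) * prod_list (map norm us)" .
  qed (simp add: B sum_nonneg)
qed

text \<open>Reduces arbitrary directions to those in the unit ball, over which
  \<open>form_norm\<close> takes its supremum. In the induction \<open>ws\<close> takes up the
  vectors already normalised.\<close>

lemma nabla_sgn:
  "length vs + length ws \<le> p \<Longrightarrow> nabla f (vs @ ws) x = prod_list (map norm vs) * nabla f (map sgn vs @ ws) x"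
proof (induction vs arbitrary: ws)
  case (Cons v vs)
  have "nabla f ((v # vs) @ ws) x = nabla f ((norm v *\<^sub>R sgn v) # vs @ ws) x"
    by (cases "v = 0") (simp_all del: nabla.simps add: sgn_div_norm)
  also have "\<dots> = norm v * nabla f (sgn v # vs @ ws) x"
    using Cons.prems by (intro nabla_scale) simp
  also have "nabla f (sgn v # vs @ ws) = nabla f (vs @ sgn v # ws)"
    using Cons.prems by (intro nabla_move_front[symmetric]) simp
  also have "nabla f (vs @ sgn v # ws) x = prod_list (map norm vs) * nabla f (map sgn vs @ sgn v # ws) x"
    using Cons.prems by (intro Cons.IH) simp
  also have "nabla f (map sgn vs @ sgn v # ws) = nabla f (sgn v # map sgn vs @ ws)"
    using Cons.prems by (intro nabla_move_front) simp
  finally show ?case by simp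
qed simp

end

section \<open>The Lipschitz bound on the derivative of order \<open>p\<close>\<close>

locale lipschitz_function = smooth_function p f for p :: nat and f :: "'a::euclidean_space \<Rightarrow> real" +
  fixes L :: real
  assumes lip: "lipschitz_derivative p L f" and p1: "1 \<le> p" and L0: "0 < L"
begin

text \<open>The real supremum in \<open>form_norm\<close> dominates its members only if they are
  bounded above, which \<open>nabla_bounded\<close> at both points guarantees. Homogeneity then
  removes the restriction to the unit ball.\<close>

lemma nabla_lipschitz:
  assumes "length vs = p"
  shows "\<bar>nabla f vs x - nabla f vs y\<bar> \<le> L * norm (x - y) * prod_list (map norm vs)"
proof -
  obtain B C where B: "B \<ge> 0" "\<And>vs. length vs = p \<Longrightarrow> \<bar>nabla f vs x\<bar> \<le> B * prod_list (map norm vs)"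
    and C: "C \<ge> 0" "\<And>vs. length vs = p \<Longrightarrow> \<bar>nabla f vs y\<bar> \<le> C * prod_list (map norm vs)"
    using nabla_bounded[of "[]" p x] nabla_bounded[of "[]" p y] by auto
  define S where "S = {vs::'a list. length vs = p \<and> (\<forall>v\<in>set vs. norm v \<le> 1)}"
  have prod1: "prod_list (map norm vs) \<le> 1" if "\<forall>v\<in>set vs. norm v \<le> 1" for vs :: "'a list"
    using that by (induction vs) (auto intro!: mult_le_one)
  have "bdd_above ((\<lambda>vs. \<bar>nabla f vs x - nabla f vs y\<bar>) ` S)"
  proof (rule bdd_aboveI2)
    fix vs assume vs: "vs \<in> S"
    then have "\<bar>nabla f vs x\<bar> \<le> B" "\<bar>nabla f vs y\<bar> \<le> C"
      using B C prod1[of vs] mult_left_le[of "prod_list (map norm vs)" B] mult_left_le[of "prod_list (map norm vs)" C]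
      unfolding S_def by fastforce+
    then show "\<bar>nabla f vs x - nabla f vs y\<bar> \<le> B + C" by linarith
  qed
  moreover have "map sgn vs \<in> S" using assms by (auto simp: S_def norm_sgn)
  ultimately have "\<bar>nabla f (map sgn vs) x - nabla f (map sgn vs) y\<bar> \<le> form_norm p (\<lambda>vs. nabla f vs x - nabla f vs y)"
    unfolding form_norm_def S_def[symmetric] by (intro cSUP_upper)
  also have "\<dots> \<le> L * norm (x - y)" using lip by (simp add: lipschitz_derivative_def)
  finally have *: "\<bar>nabla f (map sgn vs) x - nabla f (map sgn vs) y\<bar> \<le> L * norm (x - y)" .
  have "nabla f vs x - nabla f vs y = prod_list (map norm vs) * (nabla f (map sgn vs) x - nabla f (map sgn vs) y)"
    using nabla_sgn[of vs "[]"] assms by (simp add: algebra_simps)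
  also have "\<bar>\<dots>\<bar> \<le> prod_list (map norm vs) * (L * norm (x - y))"
    using * by (simp add: abs_mult mult_left_mono)
  finally show ?thesis by (simp add: algebra_simps)
qed

end

section \<open>Taylor polynomials\<close>

context smooth_function
begin

text \<open>\<open>tpoly n vs x z\<close> is the Taylor polynomial at \<open>x\<close>, of order \<open>n\<close> and evaluated at \<open>x + z\<close>, of the
  function \<open>nabla f vs\<close>. Keeping the directions \<open>vs\<close> general makes this family closed under
  differentiation, so that remainder estimates follow by induction on \<open>n\<close>.\<close>

definition tpoly :: "nat \<Rightarrow> 'a list \<Rightarrow> 'a \<Rightarrow> 'a \<Rightarrow> real" where
  "tpoly n vs x z = (\<Sum>i\<le>n. nabla f (replicate i z @ vs) x / fact i)"

lemma taylor_eq_tpoly: "taylor p f x y = tpoly p [] x (y - x)"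
proof -
  have "{..p} = insert 0 {1..p}" by auto
  then show ?thesis by (simp add: taylor_def tpoly_def)
qed

lemma tpoly_0 [simp]: "tpoly n vs x 0 = nabla f vs x" if "length vs + n \<le> p"
proof -
  have "nabla f (replicate (Suc i) 0 @ vs) x = 0" if "i < n" for i
    using nabla_scale[of "replicate i 0 @ vs" 0 0 x] that \<open>length vs + n \<le> p\<close> by simp
  then have "(\<Sum>i<n. nabla f (replicate (Suc i) 0 @ vs) x / fact (Suc i)) = 0"
    by (intro sum.neutral) simp
  then show ?thesis by (simp add: tpoly_def sum.atMost_shift)
qed

lemma tpoly_0_left [simp]: "tpoly 0 vs x z = nabla f vs x"
  by (simp add: tpoly_def)

text \<open>The product rule on the diagonal: by symmetry the \<open>i\<close> equal arguments
  contribute equal terms. The induction splits off one copy of \<open>z + t *\<^sub>R h\<close>,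
  where \<open>t\<close> enters linearly.\<close>

lemma nabla_replicate_derivative:
  assumes "i + length vs \<le> p"
  shows "((\<lambda>t. nabla f (replicate i (z + t *\<^sub>R h) @ vs) x) has_real_derivative
           real i * nabla f (replicate (i - 1) (z + t *\<^sub>R h) @ h # vs) x) (at t)"
  using assms
proof (induction i arbitrary: vs)
  case (Suc i)
  define u where "u t = z + t *\<^sub>R h" for t
  have split: "nabla f (replicate (Suc i) (u t) @ vs) x
      = nabla f (replicate i (u t) @ z # vs) x + t * nabla f (replicate i (u t) @ h # vs) x" for t
  proof -
    have "nabla f (u t # replicate i (u t) @ vs) x
      = nabla f (z # replicate i (u t) @ vs) x + t * nabla f (h # replicate i (u t) @ vs) x"
      using Suc.prems unfolding u_def[of t]
      by (subst nabla_add nabla_scale, simp)+ (simp del: nabla.simps)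
    moreover have "nabla f (w # replicate i (u t) @ vs) = nabla f (replicate i (u t) @ w # vs)" for w
      using Suc.prems by (intro nabla_move_front[symmetric]) simp
    ultimately show ?thesis by (simp del: nabla.simps)
  qed
  have IH: "((\<lambda>t. nabla f (replicate i (u t) @ w # vs) x) has_real_derivative
           real i * nabla f (replicate (i - 1) (u t) @ h # w # vs) x) (at t)" for w
    using Suc.IH[of "w # vs"] Suc.prems unfolding u_def by simp
  have "((\<lambda>t. nabla f (replicate (Suc i) (u t) @ vs) x) has_real_derivative
         real i * nabla f (replicate (i - 1) (u t) @ h # z # vs) x +
         (nabla f (replicate i (u t) @ h # vs) x +
          t * (real i * nabla f (replicate (i - 1) (u t) @ h # h # vs) x))) (at t)"
    unfolding split by (auto intro!: derivative_eq_intros IH simp del: nabla.simps)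
  \<comment> \<open>Moving \<open>z\<close> and \<open>h\<close> to the front lets linearity merge
    the two terms into one with the argument \<open>u t\<close>.\<close>
  moreover have "real i * nabla f (replicate (i - 1) (u t) @ h # z # vs) x
     + t * (real i * nabla f (replicate (i - 1) (u t) @ h # h # vs) x)
     = real i * nabla f (replicate i (u t) @ h # vs) x"
  proof (cases i)
    case (Suc j)
    have *: "nabla f (replicate j (u t) @ h # w # vs) = nabla f (w # replicate j (u t) @ h # vs)" for w
      using Suc.prems Suc by (intro nabla_perm) simp_all
    have "nabla f (u t # replicate j (u t) @ h # vs) x
      = nabla f (z # replicate j (u t) @ h # vs) x + t * nabla f (h # replicate j (u t) @ h # vs) x"
      using Suc.prems Suc unfolding u_def[of t]
      by (subst nabla_add nabla_scale, simp)+ (simp del: nabla.simps)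
    with Suc show ?thesis
      by (simp del: nabla.simps of_nat_Suc add: * distrib_left mult_ac)
  qed simp
  ultimately show ?case
    unfolding u_def[symmetric] by (simp del: nabla.simps add: algebra_simps)
qed simp

lemma tpoly_derivative:
  assumes "Suc n + length vs \<le> p"
  shows "((\<lambda>t. tpoly (Suc n) vs x (z + t *\<^sub>R h)) has_real_derivative tpoly n (h # vs) x (z + t *\<^sub>R h)) (at t)"
proof -
  have "((\<lambda>t. tpoly (Suc n) vs x (z + t *\<^sub>R h)) has_real_derivative
    (\<Sum>i\<le>Suc n. real i * nabla f (replicate (i - 1) (z + t *\<^sub>R h) @ h # vs) x / fact i)) (at t)"
    unfolding tpoly_def using assms
    by (intro DERIV_sum DERIV_cdivide nabla_replicate_derivative) simp
  also have "(\<Sum>i\<le>Suc n. real i * nabla f (replicate (i - 1) (z + t *\<^sub>R h) @ h # vs) x / fact i)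
     = tpoly n (h # vs) x (z + t *\<^sub>R h)"
    unfolding tpoly_def sum.atMost_Suc_shift by (simp del: nabla.simps of_nat_Suc add: fact_Suc)
  finally show ?thesis .
qed

text \<open>Expanding one copy of \<open>z\<close> at a time in the basis shows each summand to be a
  polynomial in the coordinates of \<open>z\<close>.\<close>

lemma tpoly_continuous:
  assumes "n + length vs \<le> p"
  shows "continuous_on S (tpoly n vs x)"
proof -
  have "continuous_on S (\<lambda>z. nabla f (replicate i z @ vs) x)" if "i + length vs \<le> p" for i vs
    using that
  proof (induction i arbitrary: vs)
    case (Suc i)
    have "nabla f (replicate (Suc i) z @ vs) x = (\<Sum>b\<in>Basis. (z \<bullet> b) * nabla f (replicate i z @ b # vs) x)" for z
    proof -
      have "nabla f (z # replicate i z @ vs) x = (\<Sum>b\<in>Basis. (z \<bullet> b) * nabla f (b # replicate i z @ vs) x)"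
        using Suc.prems by (intro nabla_expand) simp
      moreover have "nabla f (b # replicate i z @ vs) = nabla f (replicate i z @ b # vs)" for b
        using Suc.prems by (intro nabla_move_front[symmetric]) simp
      ultimately show ?thesis by (simp del: nabla.simps)
    qed
    then show ?case using Suc.IH Suc.prems
      by (simp del: nabla.simps) (intro continuous_intros Suc.IH; simp)
  qed simp
  then show ?thesis unfolding tpoly_def using assms
    by (intro continuous_intros) auto
qed

end

section \<open>Remainder and change-of-centre estimates\<close>

text \<open>Takes the place of integrating a bound on \<open>g'\<close>: both \<open>G - g\<close>
  and \<open>G + g\<close> are nondecreasing.\<close>

lemma abs_le_from_derivative_bound:
  fixes g G :: "real \<Rightarrow> real"
  assumes "\<And>t. 0 \<le> t \<Longrightarrow> t \<le> b \<Longrightarrow> (g has_real_derivative g' t) (at t)"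
    and "\<And>t. 0 \<le> t \<Longrightarrow> t \<le> b \<Longrightarrow> (G has_real_derivative G' t) (at t)"
    and "\<And>t. 0 \<le> t \<Longrightarrow> t \<le> b \<Longrightarrow> \<bar>g' t\<bar> \<le> G' t"
    and "\<bar>g 0\<bar> \<le> G 0" and "0 \<le> b"
  shows "\<bar>g b\<bar> \<le> G b"
proof -
  have "G 0 - g 0 \<le> G b - g b"
    by (rule DERIV_nonneg_imp_nondecreasing[OF \<open>0 \<le> b\<close>])
      (use assms(1-3) in \<open>fastforce intro!: derivative_eq_intros\<close>)
  moreover have "G 0 + g 0 \<le> G b + g b"
    by (rule DERIV_nonneg_imp_nondecreasing[OF \<open>0 \<le> b\<close>])
      (use assms(1-3) in \<open>fastforce intro!: derivative_eq_intros\<close>)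
  ultimately show ?thesis using assms(4) by linarith
qed

lemma DERIV_power_divide_fact:
  "((\<lambda>t. (t * a + b) ^ Suc n / fact (Suc n)) has_real_derivative (t * a + b) ^ n / fact n * a) (at t)"
proof -
  have "((\<lambda>t. (t * a + b) ^ Suc n) has_real_derivative real (Suc n) * (a * (t * a + b) ^ (Suc n - Suc 0))) (at t)"
    by (intro DERIV_power derivative_eq_intros) auto
  from DERIV_cdivide[OF this, of "fact (Suc n)"] show ?thesis
    by (simp only: fact_Suc diff_Suc_Suc diff_zero) (simp del: of_nat_Suc add: mult_ac)
qed

context lipschitz_function
begin

text \<open>The derivative in \<open>t\<close> of the remainder of order \<open>Suc n\<close> is the
  remainder of order \<open>n\<close> for \<open>nabla f (z # vs)\<close>. The induction hypothesis
  is therefore integrated from the centre, where the remainder vanishes.\<close>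

lemma taylor_remainder_line:
  assumes "length vs + n = p" "0 \<le> t"
  shows "\<bar>nabla f vs (x + t *\<^sub>R z) - tpoly n vs x (t *\<^sub>R z)\<bar>
         \<le> L * (t * norm z) ^ Suc n / fact (Suc n) * prod_list (map norm vs)"
  using assms
proof (induction n arbitrary: vs t)
  case 0
  then show ?case using nabla_lipschitz[of vs "x + t *\<^sub>R z" x] by (simp del: nabla.simps)
next
  case (Suc n)
  show ?case
  proof (rule abs_le_from_derivative_bound[where b = t and g = "\<lambda>t. nabla f vs (x + t *\<^sub>R z) - tpoly (Suc n) vs x (t *\<^sub>R z)"
        and g' = "\<lambda>t. nabla f (z # vs) (x + t *\<^sub>R z) - tpoly n (z # vs) x (t *\<^sub>R z)"
        and G = "\<lambda>t. L * (t * norm z) ^ Suc (Suc n) / fact (Suc (Suc n)) * prod_list (map norm vs)"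
        and G' = "\<lambda>t. L * (t * norm z) ^ Suc n / fact (Suc n) * prod_list (map norm (z # vs))"])
    fix s :: real assume s: "0 \<le> s" "s \<le> t"
    show "((\<lambda>t. nabla f vs (x + t *\<^sub>R z) - tpoly (Suc n) vs x (t *\<^sub>R z)) has_real_derivative
        nabla f (z # vs) (x + s *\<^sub>R z) - tpoly n (z # vs) x (s *\<^sub>R z)) (at s)"
      using tpoly_derivative[of n vs x 0 z s] nabla_along_line[of vs x z s] Suc.prems
      by (intro DERIV_diff) simp_all
    show "((\<lambda>t. L * (t * norm z) ^ Suc (Suc n) / fact (Suc (Suc n)) * prod_list (map norm vs)) has_real_derivative
           L * (s * norm z) ^ Suc n / fact (Suc n) * prod_list (map norm (z # vs))) (at s)"
      using DERIV_cmult[OF DERIV_power_divide_fact[of "norm z" 0 "Suc n" s], of "L * prod_list (map norm vs)"]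
      by (simp only: add_0_right list.map prod_list.Cons times_divide_eq_left times_divide_eq_right mult_ac)

    show "\<bar>nabla f (z # vs) (x + s *\<^sub>R z) - tpoly n (z # vs) x (s *\<^sub>R z)\<bar>
       \<le> L * (s * norm z) ^ Suc n / fact (Suc n) * prod_list (map norm (z # vs))"
      using Suc.IH[of "z # vs" s] Suc.prems s by simp
  qed (use Suc.prems in simp_all)
qed

lemma taylor_remainder:
  assumes "length vs + n = p"
  shows "\<bar>nabla f vs (x + z) - tpoly n vs x z\<bar> \<le> L * norm z ^ Suc n / fact (Suc n) * prod_list (map norm vs)"
  using taylor_remainder_line[of vs n 1 x z] assms by simp

text \<open>The same induction, for two expansions evaluated at the common point
  \<open>x2 + t *\<^sub>R u\<close>. At \<open>t = 0\<close> the second one is the true value at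
  \<open>x2\<close>, so the initial inequality is \<open>taylor_remainder\<close>.\<close>

lemma tpoly_change_center_line:
  assumes "length vs + n = p" "0 \<le> t"
  shows "\<bar>tpoly n vs x1 (x2 - x1 + t *\<^sub>R u) - tpoly n vs x2 (t *\<^sub>R u)\<bar>
    \<le> L / fact (Suc n) * ((t * norm u + norm (x2 - x1)) ^ Suc n - (t * norm u) ^ Suc n) * prod_list (map norm vs)"
  using assms
proof (induction n arbitrary: vs t)
  case 0
  then show ?case using nabla_lipschitz[of vs x1 x2] by (simp add: norm_minus_commute)
next
  case (Suc n)
  define d where "d = norm (x2 - x1)"
  show ?case unfolding d_def[symmetric]
  proof (rule abs_le_from_derivative_bound[where b = t and g = "\<lambda>t. tpoly (Suc n) vs x1 (x2 - x1 + t *\<^sub>R u) - tpoly (Suc n) vs x2 (t *\<^sub>R u)"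
        and g' = "\<lambda>t. tpoly n (u # vs) x1 (x2 - x1 + t *\<^sub>R u) - tpoly n (u # vs) x2 (t *\<^sub>R u)"
        and G = "\<lambda>t. L / fact (Suc (Suc n)) * ((t * norm u + d) ^ Suc (Suc n) - (t * norm u) ^ Suc (Suc n)) * prod_list (map norm vs)"
        and G' = "\<lambda>t. L / fact (Suc n) * ((t * norm u + d) ^ Suc n - (t * norm u) ^ Suc n) * prod_list (map norm (u # vs))"])
    fix s :: real assume s: "0 \<le> s" "s \<le> t"
    show "((\<lambda>t. tpoly (Suc n) vs x1 (x2 - x1 + t *\<^sub>R u) - tpoly (Suc n) vs x2 (t *\<^sub>R u)) has_real_derivative
        tpoly n (u # vs) x1 (x2 - x1 + s *\<^sub>R u) - tpoly n (u # vs) x2 (s *\<^sub>R u)) (at s)"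
      using tpoly_derivative[of n vs x2 0 u s] tpoly_derivative[of n vs x1 "x2 - x1" u s] Suc.prems
      by (intro DERIV_diff) simp_all
    show "((\<lambda>t. L / fact (Suc (Suc n)) * ((t * norm u + d) ^ Suc (Suc n) - (t * norm u) ^ Suc (Suc n)) * prod_list (map norm vs)) has_real_derivative
           L / fact (Suc n) * ((s * norm u + d) ^ Suc n - (s * norm u) ^ Suc n) * prod_list (map norm (u # vs))) (at s)"
      using DERIV_cmult[OF DERIV_diff[OF DERIV_power_divide_fact[of "norm u" d "Suc n" s] DERIV_power_divide_fact[of "norm u" 0 "Suc n" s]],
          of "L * prod_list (map norm vs)"]
      by (simp only: add_0_right list.map prod_list.Cons times_divide_eq_left times_divide_eq_right mult_ac
          right_diff_distrib left_diff_distrib diff_divide_distrib)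

    show "\<bar>tpoly n (u # vs) x1 (x2 - x1 + s *\<^sub>R u) - tpoly n (u # vs) x2 (s *\<^sub>R u)\<bar>
       \<le> L / fact (Suc n) * ((s * norm u + d) ^ Suc n - (s * norm u) ^ Suc n) * prod_list (map norm (u # vs))"
      using Suc.IH[of "u # vs" s] Suc.prems s unfolding d_def by simp
  next
    show "\<bar>tpoly (Suc n) vs x1 (x2 - x1 + 0 *\<^sub>R u) - tpoly (Suc n) vs x2 (0 *\<^sub>R u)\<bar>
       \<le> L / fact (Suc (Suc n)) * ((0 * norm u + d) ^ Suc (Suc n) - (0 * norm u) ^ Suc (Suc n)) * prod_list (map norm vs)"
      using taylor_remainder[of vs "Suc n" x1 "x2 - x1"] Suc.prems
      by (simp add: d_def abs_minus_commute del: fact_Suc power_Suc)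
  qed (use Suc.prems in simp_all)
qed

lemma tpoly_change_center:
  assumes "length vs + n = p"
  shows "\<bar>tpoly n vs x1 (y - x1) - tpoly n vs x2 (y - x2)\<bar>
    \<le> L / fact (Suc n) * ((norm (y - x2) + norm (x2 - x1)) ^ Suc n - norm (y - x2) ^ Suc n) * prod_list (map norm vs)"
  using tpoly_change_center_line[of vs n 1 x1 x2 "y - x2"] assms by simp

end

section \<open>The regularised Taylor model\<close>

lemma DERIV_norm_power_at_0:
  fixes z h :: "'a::real_inner"
  shows "((\<lambda>t. norm (z + t *\<^sub>R h) ^ (n + 2)) has_real_derivative real (n + 2) * norm z ^ n * (z \<bullet> h)) (at 0)"
proof (cases "z = 0")
  case False
  have "((\<lambda>t. norm (z + t *\<^sub>R h)) has_derivative (\<lambda>t. (t *\<^sub>R h) \<bullet> sgn z)) (at 0)"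
    by (rule has_derivative_compose[where g = norm]) (use False has_derivative_norm[of z] in \<open>auto intro!: derivative_eq_intros\<close>)
  then have "((\<lambda>t. norm (z + t *\<^sub>R h)) has_real_derivative (h \<bullet> sgn z)) (at 0)"
    by (simp add: has_field_derivative_def mult.commute[of _ "h \<bullet> sgn z"])
  from DERIV_power[OF this, of "n + 2"]
  have "((\<lambda>t. norm (z + t *\<^sub>R h) ^ (n + 2)) has_real_derivative real (n + 2) * (h \<bullet> sgn z * norm z ^ (n + 1))) (at 0)"
    by (simp del: power_Suc)
  moreover have "h \<bullet> sgn z * norm z ^ (n + 1) = norm z ^ n * (z \<bullet> h)"
    using False by (simp add: sgn_div_norm inner_commute field_simps)
  ultimately show ?thesis by (simp only: mult.assoc)
next
  case True
  \<comment> \<open>The norm itself has no derivative at the origin. The witness is the difference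
    quotient in \<open>t\<close>, which is continuous and vanishes at 0.\<close>
  show ?thesis
    unfolding CARAT_DERIV True
    by (intro exI[of _ "\<lambda>t. t * norm h ^ 2 * norm (t *\<^sub>R h) ^ n"] conjI)
      (auto simp: power_mult_distrib power2_eq_square algebra_simps abs_mult[symmetric] simp flip: power_mult_distrib
        intro!: continuous_intros)
qed

lemma abs_power_diff_le:
  fixes a b :: real
  assumes "0 \<le> a" "a \<le> M" "0 \<le> b" "b \<le> M"
  shows "\<bar>a ^ n - b ^ n\<bar> \<le> real n * M ^ (n - 1) * \<bar>a - b\<bar>"
proof (induction n)
  case (Suc n)
  show ?case
  proof (cases "n = 0")
    case False
    have "\<bar>a ^ Suc n - b ^ Suc n\<bar> = \<bar>a * (a ^ n - b ^ n) + b ^ n * (a - b)\<bar>"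
      by (simp add: algebra_simps)
    also have "\<dots> \<le> a * \<bar>a ^ n - b ^ n\<bar> + b ^ n * \<bar>a - b\<bar>"
      using assms by (intro order_trans[OF abs_triangle_ineq]) (simp add: abs_mult)
    also have "\<dots> \<le> M * (real n * M ^ (n - 1) * \<bar>a - b\<bar>) + M ^ n * \<bar>a - b\<bar>"
      using assms Suc.IH by (intro add_mono mult_mono power_mono) auto
    also have "\<dots> = real (Suc n) * M ^ (Suc n - 1) * \<bar>a - b\<bar>"
      using False by (simp add: algebra_simps flip: power_Suc)
    finally show ?thesis .
  qed simp
qed simp

text \<open>\<open>norm u ^ n *\<^sub>R u\<close> is the gradient of
  \<open>norm u ^ (n + 2) / (n + 2)\<close>; this bounds its variation on the ball of radius
  \<open>M\<close> with no second derivative of the norm.\<close>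

lemma norm_power_scaleR_diff_le:
  fixes a b :: "'a::real_normed_vector"
  assumes "norm a \<le> M" "norm b \<le> M"
  shows "norm (norm a ^ n *\<^sub>R a - norm b ^ n *\<^sub>R b) \<le> real (n + 1) * M ^ n * norm (a - b)"
proof -
  have M: "0 \<le> M" using assms norm_ge_zero order_trans by blast
  have "norm a ^ n *\<^sub>R a - norm b ^ n *\<^sub>R b = norm a ^ n *\<^sub>R (a - b) + (norm a ^ n - norm b ^ n) *\<^sub>R b"
    by (simp add: algebra_simps)
  also have "norm \<dots> \<le> norm a ^ n * norm (a - b) + \<bar>norm a ^ n - norm b ^ n\<bar> * norm b"
    by (rule order_trans[OF norm_triangle_ineq]) simp
  also have "\<dots> \<le> M ^ n * norm (a - b) + (real n * M ^ (n - 1) * norm (a - b)) * M"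
  proof (intro add_mono mult_mono power_mono assms)
    have "\<bar>norm a ^ n - norm b ^ n\<bar> \<le> real n * M ^ (n - 1) * \<bar>norm a - norm b\<bar>"
      using assms by (intro abs_power_diff_le) auto
    also have "\<dots> \<le> real n * M ^ (n - 1) * norm (a - b)"
      using M norm_triangle_ineq3 by (intro mult_left_mono) auto
    finally show "\<bar>norm a ^ n - norm b ^ n\<bar> \<le> real n * M ^ (n - 1) * norm (a - b)" .
  qed (use M in auto)
  also have "\<dots> = real (n + 1) * M ^ n * norm (a - b)"
    by (cases n) (auto simp: algebra_simps)
  finally show ?thesis .
qed

text \<open>Stands in for a Hessian bound on \<open>norm x ^ (n + 2)\<close>, which would be awkward at the origin.\<close>

lemma norm_power_scaleR_monotone:
  fixes u v :: "'a::real_inner"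
  shows "(norm u ^ n + norm v ^ n) / 2 * norm (u - v) ^ 2 \<le> (norm u ^ n *\<^sub>R u - norm v ^ n *\<^sub>R v) \<bullet> (u - v)"
proof -
  \<comment> \<open>Both powers are nondecreasing in the norm, so the factors have the same sign.
    Half of this product is exactly the gap between the two sides of the claim.\<close>
  have "0 \<le> (norm u ^ n - norm v ^ n) * (norm u ^ 2 - norm v ^ 2)"
  proof (cases "norm u \<le> norm v")
    case True
    then have "norm u ^ n \<le> norm v ^ n" "norm u ^ 2 \<le> norm v ^ 2" by (simp_all add: power_mono)
    then show ?thesis by (simp add: mult_nonpos_nonpos)
  next
    case False
    then have "norm v ^ n \<le> norm u ^ n" "norm v ^ 2 \<le> norm u ^ 2" by (simp_all add: power_mono)
    then show ?thesis by simp
  qed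
  moreover have "(norm u ^ n *\<^sub>R u - norm v ^ n *\<^sub>R v) \<bullet> (u - v) - (norm u ^ n + norm v ^ n) / 2 * norm (u - v) ^ 2
     = (norm u ^ n - norm v ^ n) * (norm u ^ 2 - norm v ^ 2) / 2"
    by (simp add: power2_norm_eq_inner inner_simps inner_commute field_simps)
  ultimately show ?thesis by linarith
qed

lemma norm_power_convex_comb_le:
  fixes v w :: "'a::real_normed_vector"
  assumes "0 \<le> t" "t \<le> 1"
  shows "norm ((1 - t) *\<^sub>R v + t *\<^sub>R w) ^ n \<le> (1 - t) * norm v ^ n + t * norm w ^ n"
proof -
  have "norm ((1 - t) *\<^sub>R v + t *\<^sub>R w) \<le> (1 - t) * norm v + t * norm w"
    using assms norm_triangle_ineq[of "(1 - t) *\<^sub>R v" "t *\<^sub>R w"] by simp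
  then have "norm ((1 - t) *\<^sub>R v + t *\<^sub>R w) ^ n \<le> ((1 - t) * norm v + t * norm w) ^ n"
    by (simp add: power_mono)
  also have "\<dots> \<le> (1 - t) * norm v ^ n + t * norm w ^ n"
  proof (cases "odd n")
    case True
    from convex_power_odd[OF this] show ?thesis
      using assms by (auto dest!: convex_onD[where x = "norm v" and y = "norm w" and t = t])
  next
    case False
    then have "even n" by simp
    from convex_power_even[OF this] show ?thesis
      using assms by (auto dest!: convex_onD[where x = "norm v" and y = "norm w" and t = t])
  qed
  finally show ?thesis .
qed

section \<open>The model and its minimizers\<close>

text \<open>The argument is the polynomial \<open>P\<close>, not \<open>f\<close>, so that a
  procedure can minimise the model from an oracle answer alone.\<close>

definition reg_taylor :: "nat \<Rightarrow> real \<Rightarrow> ('a::euclidean_space \<Rightarrow> real) \<Rightarrow> 'a \<Rightarrow> 'a \<Rightarrow> real" where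
  "reg_taylor p L P x y = P y + L / fact p * norm (y - x) ^ (p + 1)"

locale convex_lipschitz_function = lipschitz_function p f L for p :: nat and f :: "'a::euclidean_space \<Rightarrow> real" and L +
  fixes xs :: 'a
  assumes cvx: "convex_on UNIV f" and minimizer: "is_arg_min f (\<lambda>_. True) xs"
begin

lemma f_min: "f xs \<le> f y"
  using minimizer by (auto simp: is_arg_min_def not_less)

lemma above_tangent: "f y + nabla f [z - y] y \<le> f z"
proof -
  define \<phi> where "\<phi> t = f (y + t *\<^sub>R (z - y))" for t
  have "convex_on UNIV \<phi>"
  proof (rule convex_onI)
    fix t a b :: real assume "0 < t" "t < 1"
    then have "f ((1 - t) *\<^sub>R (y + a *\<^sub>R (z - y)) + t *\<^sub>R (y + b *\<^sub>R (z - y))) \<le> (1 - t) * \<phi> a + t * \<phi> b"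
      unfolding \<phi>_def using cvx by (intro convex_onD) auto
    moreover have "(1 - t) *\<^sub>R (y + a *\<^sub>R (z - y)) + t *\<^sub>R (y + b *\<^sub>R (z - y)) = y + ((1 - t) *\<^sub>R a + t *\<^sub>R b) *\<^sub>R (z - y)"
      by (simp add: algebra_simps)
    ultimately show "\<phi> ((1 - t) *\<^sub>R a + t *\<^sub>R b) \<le> (1 - t) * \<phi> a + t * \<phi> b"
      by (simp add: \<phi>_def)
  qed simp
  moreover have "(\<phi> has_real_derivative nabla f [z - y] y) (at 0)"
    using nabla_along_line[of "[]" y "z - y" 0] p1 unfolding \<phi>_def by simp
  ultimately have "nabla f [z - y] y * (1 - 0) \<le> \<phi> 1 - \<phi> 0"
    by (intro convex_on_imp_above_tangent[of UNIV]) auto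
  then show ?thesis by (simp add: \<phi>_def)
qed

lemma gradient_monotone: "nabla f [u - v] v \<le> nabla f [u - v] u"
  using above_tangent[of v u] above_tangent[of u v] nabla_scale[of "[]" "-1" "u - v" u] p1 by simp

abbreviation "model x \<equiv> reg_taylor p L (taylor p f x) x"

lemma taylor_error: "\<bar>f y - taylor p f x y\<bar> \<le> L / fact (p + 1) * norm (y - x) ^ (p + 1)"
  using taylor_remainder[of "[]" p x "y - x"] by (simp add: taylor_eq_tpoly)

text \<open>The regularisation weight is \<open>p + 1\<close> times the constant of
  \<open>taylor_error\<close>; adding or removing one error term yields the factors
  \<open>p + 2\<close> and \<open>p\<close> below.\<close>

lemma divide_fact_order: "L / fact p = (real p + 1) * (L / fact (p + 1))"
  by (simp add: divide_simps)

lemma model_lower: "f y + real p * (L / fact (p + 1)) * norm (y - x) ^ (p + 1) \<le> model x y"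
proof -
  define K where "K = L / fact (p + 1) * norm (y - x) ^ (p + 1)"
  have "model x y = taylor p f x y + (real p + 1) * K"
    by (simp only: reg_taylor_def divide_fact_order K_def mult.assoc)
  moreover have "f y + real p * (L / fact (p + 1)) * norm (y - x) ^ (p + 1) + K = f y + (real p + 1) * K"
    by (simp add: K_def algebra_simps add_divide_distrib del: fact_Suc power_Suc)
  ultimately show ?thesis using taylor_error[of y x] unfolding K_def[symmetric] by linarith
qed

lemma model_upper: "model x y \<le> f y + (real p + 2) * (L / fact (p + 1)) * norm (y - x) ^ (p + 1)"
proof -
  define K where "K = L / fact (p + 1) * norm (y - x) ^ (p + 1)"
  have "model x y = taylor p f x y + (real p + 1) * K"
    by (simp only: reg_taylor_def divide_fact_order K_def mult.assoc)
  moreover have "f y + (real p + 2) * (L / fact (p + 1)) * norm (y - x) ^ (p + 1) = f y + (real p + 1) * K + K"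
    by (simp add: K_def algebra_simps add_divide_distrib del: fact_Suc power_Suc)
  ultimately show ?thesis using taylor_error[of y x] unfolding K_def[symmetric] by linarith
qed

text \<open>\<open>model_lower\<close> together with \<open>f xs \<le> f z\<close> makes the
  continuous model coercive.\<close>

lemma model_arg_min_exists: "\<exists>y. is_arg_min (model x) (\<lambda>_. True) y"
proof -
  define c where "c = real p * (L / fact (p + 1))"
  have c: "c > 0" using p1 L0 by (simp add: c_def del: fact_Suc)
  \<comment> \<open>At distance at least \<open>r \<ge> 1\<close> the lower bound on the model
    exceeds \<open>f xs\<close> by at least \<open>c * r\<close>, hence already reaches
    \<open>model x x\<close>.\<close>
  define r where "r = 1 + (model x x - f xs) / c"
  have "model x x \<ge> f xs" using model_lower[of x x] f_min[of x] by simp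
  then have r: "r \<ge> 1" using c by (simp add: r_def)
  have "continuous_on (cball x r) (model x)"
    unfolding reg_taylor_def taylor_eq_tpoly
    by (intro continuous_intros continuous_on_compose2[OF tpoly_continuous]) auto
  then obtain y where y: "y \<in> cball x r" "\<And>z. z \<in> cball x r \<Longrightarrow> model x y \<le> model x z"
    using continuous_attains_inf[of "cball x r" "model x"] r by fastforce
  have "model x y \<le> model x z" for z
  proof (cases "z \<in> cball x r")
    case False
    then have "norm (z - x) \<ge> r" by (simp add: dist_norm norm_minus_commute)
    moreover have "norm (z - x) ^ 1 \<le> norm (z - x) ^ (p + 1)"
      using calculation r by (intro power_increasing) auto
    ultimately have "r \<le> norm (z - x) ^ (p + 1)" by simp
    then have "c * r \<le> c * norm (z - x) ^ (p + 1)" using c by simp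
    moreover have "c * r \<ge> model x x - f xs" using c by (simp add: r_def field_simps)
    ultimately have "model x x \<le> model x z"
      using model_lower[of z x] f_min[of z] unfolding c_def by linarith
    moreover have "model x y \<le> model x x" using y r by simp
    ultimately show ?thesis by simp
  qed (use y in auto)
  then show ?thesis by (auto simp: is_arg_min_def not_less intro!: exI[of _ y])
qed

text \<open>Compare the model values at \<open>y\<close> and \<open>xs\<close>: the values of
  \<open>f\<close> drop out, and the powers of the distances have ratio at most
  \<open>(p + 2) / p \<le> 3 \<le> 3 ^ (p + 1)\<close>.\<close>

lemma arg_min_displacement:
  assumes "is_arg_min (model x) (\<lambda>_. True) y"
  shows "norm (y - x) \<le> 3 * norm (x - xs)"
proof -
  define K where "K = L / fact (p + 1)"
  have K: "K > 0" using L0 by (simp add: K_def del: fact_Suc)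
  have "model x y \<le> model x xs" using assms by (auto simp: is_arg_min_def not_less)
  then have "real p * K * norm (y - x) ^ (p + 1) \<le> (real p + 2) * K * norm (xs - x) ^ (p + 1)"
    using model_lower[of y x] model_upper[of x xs] f_min[of y] unfolding K_def by linarith
  also have "\<dots> \<le> (3 * real p) * K * norm (xs - x) ^ (p + 1)"
    using K p1 by (intro mult_right_mono) auto
  finally have "(real p * K) * norm (y - x) ^ (p + 1) \<le> (real p * K) * (3 * norm (xs - x) ^ (p + 1))"
    by (simp add: mult_ac)
  then have "norm (y - x) ^ (p + 1) \<le> 3 * norm (xs - x) ^ (p + 1)"
    using K p1 by (subst (asm) mult_le_cancel_left_pos) auto
  also have "\<dots> \<le> 3 ^ (p + 1) * norm (xs - x) ^ (p + 1)"
    using power_increasing[of 1 "p + 1" "3::real"] by (intro mult_right_mono) auto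
  also have "\<dots> = (3 * norm (xs - x)) ^ (p + 1)" by (simp only: power_mult_distrib)
  finally have "norm (y - x) \<le> 3 * norm (xs - x)"
    unfolding Suc_eq_plus1[symmetric] by (rule power_le_imp_le_base) simp
  then show ?thesis by (simp add: norm_minus_commute)
qed

text \<open>The directional derivative of \<open>model x\<close> at \<open>y\<close> along
  \<open>h\<close>.\<close>

definition model_grad :: "'a \<Rightarrow> 'a \<Rightarrow> 'a \<Rightarrow> real" where
  "model_grad x y h = tpoly (p - 1) [h] x (y - x)
     + L / fact p * ((real p + 1) * ((norm (y - x) ^ (p - 1) *\<^sub>R (y - x)) \<bullet> h))"

lemma model_grad_zero:
  assumes "is_arg_min (model x) (\<lambda>_. True) y"
  shows "model_grad x y h = 0"
proof -
  define \<phi> where "\<phi> t = model x (y + t *\<^sub>R h)" for t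
  have p: "Suc (p - 1) = p" "p - 1 + 2 = p + 1" using p1 by auto
  have "(\<phi> has_real_derivative model_grad x y h) (at 0)"
  proof -
    have "((\<lambda>t. tpoly p [] x ((y - x) + t *\<^sub>R h)) has_real_derivative tpoly (p - 1) [h] x (y - x)) (at 0)"
      using tpoly_derivative[of "p - 1" "[]" x "y - x" h 0] p by simp
    moreover have "((\<lambda>t. norm ((y - x) + t *\<^sub>R h) ^ (p + 1)) has_real_derivative (real p + 1) * ((norm (y - x) ^ (p - 1) *\<^sub>R (y - x)) \<bullet> h)) (at 0)"
      using DERIV_norm_power_at_0[of "y - x" h "p - 1"] unfolding p by (simp add: algebra_simps)
    ultimately have "((\<lambda>t. tpoly p [] x ((y - x) + t *\<^sub>R h) + L / fact p * norm ((y - x) + t *\<^sub>R h) ^ (p + 1))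
        has_real_derivative model_grad x y h) (at 0)"
      unfolding model_grad_def by (intro DERIV_add DERIV_cmult)
    moreover have "\<phi> = (\<lambda>t. tpoly p [] x ((y - x) + t *\<^sub>R h) + L / fact p * norm ((y - x) + t *\<^sub>R h) ^ (p + 1))"
      by (simp add: \<phi>_def reg_taylor_def taylor_eq_tpoly algebra_simps fun_eq_iff)
    ultimately show ?thesis by simp
  qed
  moreover have "\<phi> 0 \<le> \<phi> t" for t using assms by (auto simp: is_arg_min_def not_less \<phi>_def)
  ultimately show ?thesis
    using DERIV_local_min[of \<phi> _ 0 1] by auto
qed

lemma gradient_taylor_error:
  "\<bar>nabla f [h] y - tpoly (p - 1) [h] x (y - x)\<bar> \<le> L / fact p * norm (y - x) ^ p * norm h"
  using taylor_remainder[of "[h]" "p - 1" x "y - x"] p1 by (simp add: divide_simps)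

lemma fact_order_reduce: "(fact p :: real) = real p * fact (p - 1)"
  using p1 by (metis One_nat_def Suc_pred fact_Suc less_eq_Suc_le)

text \<open>Stationarity of the model turns the Taylor gradient into a multiple of
  \<open>y - x\<close>. Thus \<open>lam *\<^sub>R g + (y - x)\<close> is
  \<open>1 - eta * (p + 1) / p\<close> times \<open>y - x\<close>, up to an error of norm
  \<open>eta / p * norm (y - x)\<close>. The bound on \<open>eta\<close> makes the first coefficient
  nonnegative, and the two add up to \<open>1 - eta\<close>.\<close>

lemma inexact_proximal_step:
  assumes "is_arg_min (model x) (\<lambda>_. True) y" and "GDERIV f y :> g"
    and eta: "eta = lam * (L * norm (y - x) ^ (p - 1) / fact (p - 1))"
    and "0 \<le> lam" "eta \<le> real p / (real p + 1)"
  shows "norm (lam *\<^sub>R g + (y - x)) \<le> (1 - eta) * norm (y - x)"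
proof -
  define r where "r = norm (y - x)"
  define h where "h = lam *\<^sub>R g + (y - x)"
  have g: "nabla f [v] y = g \<bullet> v" for v
    using frechet_derivative_at[OF assms(2)[unfolded gderiv_def]] by (metis inner_commute nabla.simps)
  have c: "lam * (L / fact p * r ^ (p - 1)) = eta / p" by (simp add: eta fact_order_reduce r_def)
  have pp: "r ^ p = r ^ (p - 1) * r" using p1 by (metis power_minus_mult le_less_trans less_eq_Suc_le One_nat_def Suc_le_eq)
  have eta0: "eta * (real p + 1) / real p \<le> 1" using assms(5) p1 by (simp add: field_simps)
  \<comment> \<open>The vector is paired with itself, so that the directional estimates in direction
    \<open>h\<close> apply; one factor \<open>norm h\<close> is cancelled at the end.\<close>
  have "norm h ^ 2 = lam * (g \<bullet> h) + (y - x) \<bullet> h"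
    by (simp add: h_def power2_norm_eq_inner inner_simps inner_commute algebra_simps)
  also have "\<dots> = lam * (nabla f [h] y - tpoly (p - 1) [h] x (y - x)) + lam * tpoly (p - 1) [h] x (y - x) + (y - x) \<bullet> h"
    by (simp add: g right_diff_distrib del: nabla.simps)
  also have "lam * tpoly (p - 1) [h] x (y - x) = - (eta * (real p + 1) / real p) * ((y - x) \<bullet> h)"
  proof -
    have "tpoly (p - 1) [h] x (y - x) = - (L / fact p * r ^ (p - 1)) * (real p + 1) * ((y - x) \<bullet> h)"
      using model_grad_zero[OF assms(1), of h] by (simp add: model_grad_def r_def mult_ac eq_neg_iff_add_eq_0)
    then have "lam * tpoly (p - 1) [h] x (y - x) = - (lam * (L / fact p * r ^ (p - 1))) * (real p + 1) * ((y - x) \<bullet> h)"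
      by (simp only:) (simp only: mult_ac mult_minus_left mult_minus_right)
    then show ?thesis unfolding c by simp
  qed
  also have "lam * (nabla f [h] y - tpoly (p - 1) [h] x (y - x)) \<le> lam * (L / fact p * r ^ p * norm h)"
    using gradient_taylor_error[of h y x] \<open>0 \<le> lam\<close> unfolding r_def by (intro mult_left_mono) (auto simp del: nabla.simps)
  also have "lam * (L / fact p * r ^ p * norm h) = eta / p * r * norm h"
    unfolding pp c[symmetric] by (simp only: mult_ac times_divide_eq_left times_divide_eq_right)
  also have "eta / p * r * norm h + - (eta * (real p + 1) / real p) * ((y - x) \<bullet> h) + (y - x) \<bullet> h
     = eta / p * r * norm h + (1 - eta * (real p + 1) / real p) * ((y - x) \<bullet> h)"
    by (simp add: algebra_simps)
  also have "\<dots> \<le> eta / p * r * norm h + (1 - eta * (real p + 1) / real p) * (r * norm h)"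
    using eta0 norm_cauchy_schwarz[of "y - x" h] unfolding r_def by (intro add_left_mono mult_left_mono) auto
  also have "\<dots> = (1 - eta) * r * norm h" using p1 by (simp add: field_simps)
  finally have *: "norm h * norm h \<le> (1 - eta) * r * norm h" by (simp add: power2_eq_square)
  show ?thesis
  proof (cases "norm h = 0")
    case True
    have "eta \<le> 1" using assms(5) by (rule order_trans) simp
    then show ?thesis using True by (simp add: h_def[symmetric])
  next
    case False
    then show ?thesis using * by (simp add: h_def[symmetric] r_def[symmetric])
  qed
qed

section \<open>Monotonicity of the model gradient and dependence on the centre\<close>

text \<open>A Taylor polynomial of a convex function need not be convex; the remainder of the second
  derivative limits the failure. The mean of the powers at both ends is the quantity that
  \<open>norm_power_scaleR_monotone\<close> supplies with a positive sign.\<close>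

lemma tpoly_gradient_monotone:
  assumes "2 \<le> p"
  shows "- (L / fact (p - 1) * ((norm u ^ (p - 1) + norm v ^ (p - 1)) / 2) * norm (u - v) ^ 2)
     \<le> tpoly (p - 1) [u - v] x u - tpoly (p - 1) [u - v] x v"
proof -
  define h where "h = u - v"
  define K where "K = L / fact (p - 1) * norm h ^ 2"
  have K: "K \<ge> 0" using L0 by (simp add: K_def)
  have p: "Suc (p - 2) = p - 1" using assms by simp
  \<comment> \<open>The last term of \<open>G\<close> integrates the bound on the remainder of the second derivative, since the
    power of the norm is convex along the segment. Working with the difference to the true gradient
    avoids the Hessian of \<open>f\<close>: convexity enters only through the monotonicity of the gradient.\<close>
  define G where "G t = tpoly (p - 1) [h] x (v + t *\<^sub>R h) - nabla f [h] (x + v + t *\<^sub>R h)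
     + K * ((t - t\<^sup>2 / 2) * norm v ^ (p - 1) + t\<^sup>2 / 2 * norm u ^ (p - 1))" for t
  have "G 0 \<le> G 1"
  proof (rule DERIV_nonneg_imp_nondecreasing[of 0 1 G])
    fix t :: real assume t: "0 \<le> t" "t \<le> 1"
    let ?G' = "tpoly (p - 2) [h, h] x (v + t *\<^sub>R h) - nabla f [h, h] (x + v + t *\<^sub>R h)
     + K * ((1 - t) * norm v ^ (p - 1) + t * norm u ^ (p - 1))"
    have "(G has_real_derivative ?G') (at t)"
      unfolding G_def
    proof (intro DERIV_add DERIV_diff DERIV_cmult)
      show "((\<lambda>t. tpoly (p - 1) [h] x (v + t *\<^sub>R h)) has_real_derivative tpoly (p - 2) [h, h] x (v + t *\<^sub>R h)) (at t)"
        using tpoly_derivative[of "p - 2" "[h]" x v h t] assms unfolding p by simp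
      show "((\<lambda>t. nabla f [h] (x + v + t *\<^sub>R h)) has_real_derivative nabla f [h, h] (x + v + t *\<^sub>R h)) (at t)"
        using nabla_along_line[of "[h]" "x + v" h t] assms by simp
      show "((\<lambda>t. (t - t\<^sup>2 / 2) * norm v ^ (p - 1)) has_real_derivative (1 - t) * norm v ^ (p - 1)) (at t)"
       "((\<lambda>t. t\<^sup>2 / 2 * norm u ^ (p - 1)) has_real_derivative t * norm u ^ (p - 1)) (at t)"
        by (auto intro!: derivative_eq_intros)
    qed
    moreover have "0 \<le> ?G'"
    proof -
      have "\<bar>nabla f [h, h] (x + (v + t *\<^sub>R h)) - tpoly (p - 2) [h, h] x (v + t *\<^sub>R h)\<bar> \<le> K * norm (v + t *\<^sub>R h) ^ (p - 1)"
        using taylor_remainder[of "[h, h]" "p - 2" x "v + t *\<^sub>R h"] assms unfolding p K_def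
        by (simp add: power2_eq_square mult_ac del: nabla.simps)
      also have "v + t *\<^sub>R h = (1 - t) *\<^sub>R v + t *\<^sub>R u" by (simp add: h_def algebra_simps)
      also have "K * norm \<dots> ^ (p - 1) \<le> K * ((1 - t) * norm v ^ (p - 1) + t * norm u ^ (p - 1))"
        using K t by (intro mult_left_mono norm_power_convex_comb_le)
      finally show ?thesis by (simp add: h_def algebra_simps del: nabla.simps)
    qed
    ultimately show "\<exists>d. (G has_real_derivative d) (at t) \<and> d \<ge> 0" by blast
  next
    show "0 \<le> (1::real)" by simp
  qed
  moreover have "G 1 = tpoly (p - 1) [h] x u - nabla f [h] (x + u) + K * ((norm u ^ (p - 1) + norm v ^ (p - 1)) / 2)"
    by (simp add: G_def h_def algebra_simps del: nabla.simps)
  moreover have "G 0 = tpoly (p - 1) [h] x v - nabla f [h] (x + v)"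
    by (simp add: G_def del: nabla.simps)
  moreover have "nabla f [h] (x + v) \<le> nabla f [h] (x + u)"
    using gradient_monotone[of "x + u" "x + v"] by (simp add: h_def del: nabla.simps)
  ultimately show ?thesis by (simp add: K_def h_def mult_ac del: nabla.simps)
qed

text \<open>In units of \<open>L / fact p * S\<close>, the regulariser gains \<open>p + 1\<close>
  and the Taylor polynomial loses at most \<open>p\<close>, so one unit remains.\<close>

lemma model_grad_strong_monotone:
  assumes "2 \<le> p"
  shows "L / (2 * fact p) * (norm (y - x) ^ (p - 1) + norm (z - x) ^ (p - 1)) * norm (y - z) ^ 2
     \<le> model_grad x y (y - z) - model_grad x z (y - z)"
proof -
  define u v where uv: "u = y - x" "v = z - x"
  have h: "y - z = u - v" by (simp add: uv)
  define S where "S = (norm u ^ (p - 1) + norm v ^ (p - 1)) / 2 * norm (u - v) ^ 2"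
  have "- (L / fact p * (real p * S)) \<le> tpoly (p - 1) [u - v] x u - tpoly (p - 1) [u - v] x v"
    using tpoly_gradient_monotone[OF assms, of u v x] assms by (simp add: S_def fact_order_reduce mult.assoc)
  moreover have "L / fact p * ((real p + 1) * S) \<le> L / fact p * ((real p + 1) * ((norm u ^ (p - 1) *\<^sub>R u - norm v ^ (p - 1) *\<^sub>R v) \<bullet> (u - v)))"
    using norm_power_scaleR_monotone[of u "p - 1" v] L0 unfolding S_def by (intro mult_left_mono) auto
  moreover have "L / fact p * ((real p + 1) * S) - L / fact p * (real p * S)
     = L / (2 * fact p) * (norm u ^ (p - 1) + norm v ^ (p - 1)) * norm (u - v) ^ 2"
    by (simp add: S_def field_simps)
  ultimately show ?thesis unfolding model_grad_def h uv(1,2)[symmetric]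
    by (simp only: inner_diff_left right_diff_distrib)
qed

text \<open>The Taylor part contributes \<open>p\<close> and the regulariser
  \<open>(p + 1) * p\<close>, together \<open>p * (p + 2)\<close>.\<close>

lemma model_grad_change_center:
  assumes "norm (y - x2) + norm (x2 - x1) \<le> M"
  shows "\<bar>model_grad x1 y h - model_grad x2 y h\<bar> \<le> L / fact p * (real p * (real p + 2)) * norm (x2 - x1) * M ^ (p - 1) * norm h"
proof -
  define d where "d = norm (x2 - x1)"
  have p: "Suc (p - 1) = p" "real (p - 1 + 1) = p" using p1 by auto
  have n1: "norm (y - x1) \<le> M"
    using norm_triangle_ineq[of "y - x2" "x2 - x1"] assms by simp
  have n2: "norm (y - x2) \<le> M"
    using norm_ge_zero[of "x2 - x1"] assms by linarith
  have "\<bar>tpoly (p - 1) [h] x1 (y - x1) - tpoly (p - 1) [h] x2 (y - x2)\<bar> \<le> L / fact p * (real p * M ^ (p - 1) * d) * norm h"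
  proof -
    have "\<bar>tpoly (p - 1) [h] x1 (y - x1) - tpoly (p - 1) [h] x2 (y - x2)\<bar>
      \<le> L / fact p * ((norm (y - x2) + d) ^ p - norm (y - x2) ^ p) * norm h"
      using tpoly_change_center[of "[h]" "p - 1" x1 y x2] p1 unfolding p d_def by simp
    also have "\<dots> \<le> L / fact p * (real p * M ^ (p - 1) * d) * norm h"
      using abs_power_diff_le[of "norm (y - x2) + d" M "norm (y - x2)" p] assms L0 n2
      by (intro mult_right_mono mult_left_mono) (auto simp: d_def)
    finally show ?thesis .
  qed
  moreover have "\<bar>(norm (y - x1) ^ (p - 1) *\<^sub>R (y - x1)) \<bullet> h - (norm (y - x2) ^ (p - 1) *\<^sub>R (y - x2)) \<bullet> h\<bar>
    \<le> (real p * M ^ (p - 1) * d) * norm h"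
  proof -
    have "\<bar>(norm (y - x1) ^ (p - 1) *\<^sub>R (y - x1) - norm (y - x2) ^ (p - 1) *\<^sub>R (y - x2)) \<bullet> h\<bar>
     \<le> norm (norm (y - x1) ^ (p - 1) *\<^sub>R (y - x1) - norm (y - x2) ^ (p - 1) *\<^sub>R (y - x2)) * norm h"
      by (rule Cauchy_Schwarz_ineq2)
    also have "\<dots> \<le> (real p * M ^ (p - 1) * d) * norm h"
      using norm_power_scaleR_diff_le[OF n1 n2, of "p - 1"] unfolding p d_def
      by (intro mult_right_mono) auto
    finally show ?thesis by (simp add: inner_diff_left)
  qed
  then have "L / fact p * ((real p + 1) * \<bar>(norm (y - x1) ^ (p - 1) *\<^sub>R (y - x1)) \<bullet> h - (norm (y - x2) ^ (p - 1) *\<^sub>R (y - x2)) \<bullet> h\<bar>)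
    \<le> L / fact p * ((real p + 1) * ((real p * M ^ (p - 1) * d) * norm h))"
    using L0 by (intro mult_left_mono) auto
  then have "\<bar>L / fact p * ((real p + 1) * ((norm (y - x1) ^ (p - 1) *\<^sub>R (y - x1)) \<bullet> h)) - L / fact p * ((real p + 1) * ((norm (y - x2) ^ (p - 1) *\<^sub>R (y - x2)) \<bullet> h))\<bar>
    \<le> L / fact p * ((real p + 1) * ((real p * M ^ (p - 1) * d) * norm h))"
    using L0 by (simp only: right_diff_distrib[symmetric] abs_mult) simp
  ultimately have "\<bar>model_grad x1 y h - model_grad x2 y h\<bar> \<le> L / fact p * (real p * M ^ (p - 1) * d) * norm h
     + L / fact p * ((real p + 1) * ((real p * M ^ (p - 1) * d) * norm h))"
    unfolding model_grad_def by linarith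
  also have "\<dots> = L / fact p * (real p * (real p + 2)) * d * M ^ (p - 1) * norm h"
    by (simp add: algebra_simps)
  finally show ?thesis unfolding d_def .
qed

text \<open>Both the strong convexity modulus of the model and its sensitivity to the expansion point scale
  like the \<open>p - 1\<close>st power of the displacement; they cancel, and the constant is independent of \<open>f\<close>.\<close>

lemma arg_min_distance_far:
  assumes "2 \<le> p" "is_arg_min (model x1) (\<lambda>_. True) y1" "is_arg_min (model x2) (\<lambda>_. True) y2"
    and far: "2 * norm (x2 - x1) \<le> norm (y2 - x2)" and ne: "x1 \<noteq> x2"
  shows "norm (y2 - y1) \<le> 2 * real p * (real p + 2) * 3 ^ (p - 1) * norm (x2 - x1)"
proof -
  define d where "d = norm (x2 - x1)"
  define s where "s = norm (y2 - x1)"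
  have d: "d > 0" using ne by (simp add: d_def)
  \<comment> \<open>Since \<open>s \<ge> norm (y2 - x2) - d\<close> and
    \<open>norm (y2 - x2) \<ge> 2 * d\<close>, the radius of the centre change is at most
    \<open>3 * s\<close>. This is the source of \<open>3 ^ (p - 1)\<close>.\<close>
  have s: "norm (y2 - x2) + d \<le> 3 * s" "s > 0"
    using norm_triangle_ineq2[of "y2 - x2" "x1 - x2"] far d
    by (auto simp: s_def d_def norm_minus_commute)
  have "L / (2 * fact p) * s ^ (p - 1) * norm (y2 - y1) ^ 2
    \<le> L / (2 * fact p) * (s ^ (p - 1) + norm (y1 - x1) ^ (p - 1)) * norm (y2 - y1) ^ 2"
    using L0 by (intro mult_right_mono mult_left_mono) auto
  also have "\<dots> \<le> model_grad x1 y2 (y2 - y1) - model_grad x1 y1 (y2 - y1)"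
    using model_grad_strong_monotone[OF assms(1), of y2 x1 y1] unfolding s_def .
  also have "\<dots> \<le> \<bar>model_grad x1 y2 (y2 - y1) - model_grad x2 y2 (y2 - y1)\<bar>"
    using model_grad_zero[OF assms(2)] model_grad_zero[OF assms(3)] by simp
  also have "\<dots> \<le> L / fact p * (real p * (real p + 2)) * d * (3 * s) ^ (p - 1) * norm (y2 - y1)"
    unfolding d_def by (rule model_grad_change_center) (use s in \<open>simp add: d_def\<close>)
  also have "\<dots> = (L / (2 * fact p) * s ^ (p - 1)) * (2 * real p * (real p + 2) * 3 ^ (p - 1) * d * norm (y2 - y1))"
    by (simp add: power_mult_distrib)
  finally have "norm (y2 - y1) ^ 2 \<le> 2 * real p * (real p + 2) * 3 ^ (p - 1) * d * norm (y2 - y1)"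
    using L0 s by (subst (asm) mult.assoc, subst (asm) mult_le_cancel_left_pos) (auto intro!: mult_pos_pos divide_pos_pos)
  then show ?thesis using d by (cases "y2 = y1") (auto simp: power2_eq_square d_def)
qed

definition "lip_const = 2 * real p * (real p + 2) * 3 ^ (p - 1) + 1"

text \<open>If either displacement is at least twice the distance of the centres,
  \<open>arg_min_distance_far\<close> applies, with the roles exchanged if necessary; the triangle
  inequality adds the 1 in \<open>lip_const\<close>. Otherwise both displacements are small and so
  is their difference.\<close>

lemma displacement_lipschitz:
  assumes "2 \<le> p" "is_arg_min (model x1) (\<lambda>_. True) y1" "is_arg_min (model x2) (\<lambda>_. True) y2" "x1 \<noteq> x2"
  shows "\<bar>norm (y1 - x1) - norm (y2 - x2)\<bar> \<le> lip_const * norm (x2 - x1)"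
proof -
  define r1 r2 d where defs: "r1 = norm (y1 - x1)" "r2 = norm (y2 - x2)" "d = norm (x2 - x1)"
  have tri: "\<bar>r1 - r2\<bar> \<le> norm (y2 - y1) + d"
    using norm_triangle_ineq3[of "y1 - x1" "y2 - x2"] norm_triangle_ineq[of "y1 - y2" "x2 - x1"]
    by (simp add: defs norm_minus_commute algebra_simps)
  consider "2 * d \<le> r2" | "2 * d \<le> r1" | "r1 < 2 * d" "r2 < 2 * d" by linarith
  then have "\<bar>r1 - r2\<bar> \<le> lip_const * d"
  proof cases
    case 1
    then show ?thesis using arg_min_distance_far[OF assms(1-3)] assms(4) tri
      by (simp add: defs lip_const_def algebra_simps)
  next
    case 2
    then show ?thesis using arg_min_distance_far[OF assms(1,3,2)] assms(4) tri
      by (simp add: defs lip_const_def algebra_simps norm_minus_commute)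
  next
    case 3
    have "2 * d \<le> lip_const * d"
    proof (intro mult_right_mono)
      have "1 * 1 * 1 \<le> (2 * real p) * (real p + 2) * 3 ^ (p - 1)"
        using p1 by (intro mult_mono) auto
      then show "2 \<le> lip_const" by (simp add: lip_const_def)
    qed (simp add: defs)
    moreover have "\<bar>r1 - r2\<bar> \<le> 2 * d" using 3 norm_ge_zero[of "y1 - x1"] norm_ge_zero[of "y2 - x2"] defs by linarith
    ultimately show ?thesis by simp
  qed
  then show ?thesis by (simp add: defs)
qed

end

section \<open>Rate of convergence\<close>

text \<open>\<open>step_size lam A\<close> is the positive root of
  \<open>a\<^sup>2 = lam * (A + a)\<close>. The last property comes from dropping
  \<open>lam\<^sup>2\<close> under the root and completing a square.\<close>

lemma step_size_props:
  assumes "0 < lam" "0 \<le> A"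
  defines "a \<equiv> step_size lam A"
  shows "lam \<le> a" "0 < a" "a\<^sup>2 = lam * (A + a)" "sqrt A + sqrt lam / 2 \<le> sqrt (A + a)"
proof -
  have nn: "0 \<le> lam\<^sup>2 + 4 * lam * A" using assms by simp
  have s: "sqrt (lam\<^sup>2 + 4 * lam * A) = 2 * a - lam" by (simp add: a_def step_size_def field_simps)
  have "lam \<le> sqrt (lam\<^sup>2 + 4 * lam * A)" by (rule real_le_rsqrt) (use assms in simp)
  then show la: "lam \<le> a" unfolding s by simp
  then show "0 < a" using assms by simp
  have "(2 * a - lam)\<^sup>2 = lam\<^sup>2 + 4 * lam * A" using nn unfolding s[symmetric] by (rule real_sqrt_pow2)
  then show *: "a\<^sup>2 = lam * (A + a)" by (simp add: power2_eq_square algebra_simps)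
  have "sqrt (4 * lam * A) \<le> 2 * a - lam" unfolding s[symmetric] by (simp add: assms)
  then have "2 * (sqrt lam * sqrt A) \<le> 2 * a - lam" by (simp add: real_sqrt_mult)
  then have "(sqrt A + sqrt lam / 2)\<^sup>2 \<le> A + a"
    using assms by (simp add: power2_sum field_simps)
  then show "sqrt A + sqrt lam / 2 \<le> sqrt (A + a)" by (rule real_le_rsqrt)
qed

text \<open>After division by the geometric mean \<open>G\<close>, the inequality is a weighted sum
  of \<open>ln z \<le> z - 1\<close>.\<close>

lemma weighted_arith_geom_mean:
  fixes x y s :: real
  assumes "0 \<le> x" "0 \<le> y" "0 < s" "s < 1"
  shows "x powr s * y powr (1 - s) \<le> s * x + (1 - s) * y"
proof (cases "x = 0 \<or> y = 0")
  case True
  then show ?thesis using assms by auto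
next
  case False
  then have xy: "x > 0" "y > 0" using assms by auto
  define G where "G = x powr s * y powr (1 - s)"
  have G: "G > 0" using xy by (simp add: G_def)
  have "ln G = s * ln x + (1 - s) * ln y" using xy by (simp add: G_def ln_mult ln_powr)
  moreover have "s * ln (x / G) + (1 - s) * ln (y / G) \<le> s * (x / G - 1) + (1 - s) * (y / G - 1)"
    using xy G assms by (intro add_mono mult_left_mono ln_le_minus_one) auto
  ultimately have "0 \<le> (s * x + (1 - s) * y) / G - 1"
    using xy G by (simp add: ln_div algebra_simps add_divide_distrib diff_divide_distrib)
  then show ?thesis using G by (simp add: G_def field_simps)
qed

text \<open>Hoelder's inequality for two terms: normalise by the totals \<open>U\<close> and
  \<open>V\<close>, apply the mean inequality to each pair and add; the weights sum to 1.\<close>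

lemma geometric_mean_superadditive:
  fixes s :: real
  assumes "0 \<le> u" "0 \<le> u'" "0 \<le> v" "0 \<le> v'" "0 < s" "s < 1"
  shows "u powr s * v powr (1 - s) + u' powr s * v' powr (1 - s) \<le> (u + u') powr s * (v + v') powr (1 - s)"
proof (cases "u + u' = 0 \<or> v + v' = 0")
  case True
  then show ?thesis using assms by (auto simp: add_nonneg_eq_0_iff)
next
  case False
  define U V where "U = u + u'" and "V = v + v'"
  have UV: "U > 0" "V > 0" using False assms by (auto simp: U_def V_def)
  have *: "x powr s * y powr (1 - s) \<le> (s * (x / U) + (1 - s) * (y / V)) * (U powr s * V powr (1 - s))"
    if "0 \<le> x" "0 \<le> y" for x y
  proof -
    have "(x / U) powr s * (y / V) powr (1 - s) \<le> s * (x / U) + (1 - s) * (y / V)"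
      using that UV assms by (intro weighted_arith_geom_mean) auto
    moreover have "(x / U) powr s * (y / V) powr (1 - s) = x powr s * y powr (1 - s) / (U powr s * V powr (1 - s))"
      using that UV by (simp add: powr_divide)
    ultimately show ?thesis using UV by (simp add: divide_le_eq)
  qed
  have "u powr s * v powr (1 - s) + u' powr s * v' powr (1 - s)
     \<le> (s * ((u + u') / U) + (1 - s) * ((v + v') / V)) * (U powr s * V powr (1 - s))"
    using *[of u v] *[of u' v'] assms by (simp add: add_divide_distrib algebra_simps)
  also have "\<dots> = U powr s * V powr (1 - s)" using UV unfolding U_def[symmetric] V_def[symmetric] by simp
  finally show ?thesis by (simp add: U_def V_def)
qed

text \<open>The tangent inequality of a concave power, with the tangent at the new value
  \<open>w'\<close>: the old value \<open>w\<close> may be 0, where the slope is infinite.\<close>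

lemma powr_increment_ge:
  fixes w w' \<gamma> :: real
  assumes "0 \<le> w" "0 < w'" "0 < \<gamma>" "\<gamma> < 1"
  shows "w powr \<gamma> + \<gamma> * w' powr (\<gamma> - 1) * (w' - w) \<le> w' powr \<gamma>"
proof -
  have "(w / w') powr \<gamma> \<le> \<gamma> * (w / w') + (1 - \<gamma>)"
    using weighted_arith_geom_mean[of "w / w'" 1 \<gamma>] assms by simp
  then have "w powr \<gamma> / w' powr \<gamma> \<le> \<gamma> * (w / w') + (1 - \<gamma>)"
    using assms by (simp add: powr_divide)
  then have "w powr \<gamma> \<le> (\<gamma> * (w / w') + (1 - \<gamma>)) * w' powr \<gamma>"
    using assms by (simp add: divide_le_eq)
  moreover have "\<gamma> * w' powr (\<gamma> - 1) * (w' - w) = (\<gamma> - \<gamma> * (w / w')) * w' powr \<gamma>"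
    using assms by (simp add: powr_diff field_simps)
  ultimately show ?thesis by (simp only: left_diff_distrib distrib_right)
qed

section \<open>Decrease of the potential and growth of \<open>A\<close>\<close>

context convex_lipschitz_function
begin

lemma gradient_exists: "\<exists>g. GDERIV f y :> g"
proof
  have "(\<lambda>v. nabla f [v] y) = (\<lambda>v. v \<bullet> (\<Sum>b\<in>Basis. nabla f [b] y *\<^sub>R b))"
  proof
    fix v
    show "nabla f [v] y = v \<bullet> (\<Sum>b\<in>Basis. nabla f [b] y *\<^sub>R b)"
      using nabla_expand[of "[]" v y] p1 by (simp add: inner_sum_right mult.commute del: nabla.simps)
  qed
  moreover have "(f has_derivative (\<lambda>v. nabla f [v] y)) (at y)"
    using nabla_has_derivative[of "[]" y] p1 by simp
  ultimately show "GDERIV f y :> (\<Sum>b\<in>Basis. nabla f [b] y *\<^sub>R b)"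
    unfolding gderiv_def by (simp only:)
qed

lemma gradient_inequality: "GDERIV f y :> g \<Longrightarrow> f y + g \<bullet> (z - y) \<le> f z"
  using above_tangent[of y z] frechet_derivative_at[of f "\<lambda>h. h \<bullet> g" y]
  by (simp add: gderiv_def inner_commute)

lemma reg_taylor_eq: "(\<lambda>z. P z + M / fact q * norm (z - x) ^ (q + 1)) = reg_taylor q M P x"
  by (simp add: fun_eq_iff reg_taylor_def)

text \<open>Convexity at \<open>y'\<close> against \<open>y\<close> and \<open>xs\<close>, weighted
  by \<open>A\<close> and \<open>a\<close>, yields
  \<open>A' * (g \<bullet> (y' - xt)) + a * (g \<bullet> (x - xs))\<close>, because
  \<open>A' *\<^sub>R xt = A *\<^sub>R y + a *\<^sub>R x\<close>. The second term cancels in the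
  expansion of the new squared distance. As \<open>a\<^sup>2 = lam * A'\<close>, the rest completes
  to the square of \<open>lam *\<^sub>R g + (y' - xt)\<close>, which
  \<open>inexact_proximal_step\<close> bounds.\<close>

lemma potential_step:
  assumes "0 < lam" "0 \<le> A" and xt: "xt = extrapolation A x y lam" and a: "a = step_size lam A"
    and "is_arg_min (model xt) (\<lambda>_. True) y'" and g: "GDERIV f y' :> g"
    and eta: "eta = lam * (L * norm (y' - xt) ^ (p - 1) / fact (p - 1))"
    and "eta \<le> real p / (real p + 1)"
  shows "(A + a) * (f y' - f xs) + (norm (x - a *\<^sub>R g - xs))\<^sup>2 / 2
         + (1 - (1 - eta)\<^sup>2) * ((A + a) / lam * (norm (y' - xt))\<^sup>2) / 2
       \<le> A * (f y - f xs) + (norm (x - xs))\<^sup>2 / 2"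
proof -
  note ss = step_size_props[OF \<open>0 < lam\<close> \<open>0 \<le> A\<close>, folded a]
  define A' where "A' = A + a"
  have A': "A' > 0" using ss assms by (simp add: A'_def)
  have ext: "A' *\<^sub>R xt = A *\<^sub>R y + a *\<^sub>R x"
    using A' unfolding xt extrapolation_def Let_def a[symmetric] A'_def[symmetric]
    by (simp add: scaleR_add_right)
  have "A * (f y' - f y) + a * (f y' - f xs) \<le> A * (g \<bullet> (y' - y)) + a * (g \<bullet> (y' - xs))"
  proof (intro add_mono mult_left_mono)
    show "f y' - f y \<le> g \<bullet> (y' - y)" "f y' - f xs \<le> g \<bullet> (y' - xs)"
      using gradient_inequality[OF g, of y] gradient_inequality[OF g, of xs] by (simp_all add: inner_diff_right)
  qed (use ss assms in auto)
  also have "\<dots> = g \<bullet> (A' *\<^sub>R y' - (A *\<^sub>R y + a *\<^sub>R x) + a *\<^sub>R (x - xs))"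
    by (simp add: A'_def inner_simps algebra_simps)
  also have "\<dots> = A' * (g \<bullet> (y' - xt)) + a * (g \<bullet> (x - xs))"
    unfolding ext[symmetric] by (simp add: inner_simps algebra_simps)
  finally have 1: "A * (f y' - f y) + a * (f y' - f xs) \<le> A' * (g \<bullet> (y' - xt)) + a * (g \<bullet> (x - xs))" .
  have 2: "(norm (x - a *\<^sub>R g - xs))\<^sup>2 / 2 = (norm (x - xs))\<^sup>2 / 2 - a * (g \<bullet> (x - xs)) + a\<^sup>2 / 2 * (norm g)\<^sup>2"
    by (simp add: power2_norm_eq_inner inner_simps inner_commute algebra_simps power2_eq_square[of a] add_divide_distrib diff_divide_distrib)
  have a2: "a\<^sup>2 = lam * A'" using ss by (simp add: A'_def)
  have "(norm (lam *\<^sub>R g + (y' - xt)))\<^sup>2 = lam\<^sup>2 * (norm g)\<^sup>2 + 2 * lam * (g \<bullet> (y' - xt)) + (norm (y' - xt))\<^sup>2"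
    by (simp add: power2_norm_eq_inner inner_simps inner_commute algebra_simps power2_eq_square[of lam])
  then have 3: "A' * (g \<bullet> (y' - xt)) + a\<^sup>2 / 2 * (norm g)\<^sup>2
     = A' / lam * ((norm (lam *\<^sub>R g + (y' - xt)))\<^sup>2 - (norm (y' - xt))\<^sup>2) / 2"
    unfolding a2 using assms(1) by (simp add: field_simps power2_eq_square)
  have "norm (lam *\<^sub>R g + (y' - xt)) \<le> (1 - eta) * norm (y' - xt)"
    using assms by (intro inexact_proximal_step) auto
  then have "(norm (lam *\<^sub>R g + (y' - xt)))\<^sup>2 \<le> (1 - eta)\<^sup>2 * (norm (y' - xt))\<^sup>2"
    by (metis norm_ge_zero power_mono power_mult_distrib)
  then have "A' / lam * ((norm (lam *\<^sub>R g + (y' - xt)))\<^sup>2 - (norm (y' - xt))\<^sup>2) \<le> A' / lam * ((1 - eta)\<^sup>2 * (norm (y' - xt))\<^sup>2 - (norm (y' - xt))\<^sup>2)"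
    using A' assms(1) by (intro mult_left_mono) auto
  also have "\<dots> = - ((1 - (1 - eta)\<^sup>2) * (A' / lam * (norm (y' - xt))\<^sup>2))"
    by (simp only: left_diff_distrib right_diff_distrib) (simp add: mult_ac)
  finally have "A' / lam * ((norm (lam *\<^sub>R g + (y' - xt)))\<^sup>2 - (norm (y' - xt))\<^sup>2) / 2
      \<le> - ((1 - (1 - eta)\<^sup>2) * (A' / lam * (norm (y' - xt))\<^sup>2)) / 2" by (rule divide_right_mono) simp
  then have 4: "A' / lam * ((norm (lam *\<^sub>R g + (y' - xt)))\<^sup>2 - (norm (y' - xt))\<^sup>2) / 2
      \<le> - ((1 - (1 - eta)\<^sup>2) * (A' / lam * (norm (y' - xt))\<^sup>2) / 2)" by (simp only: minus_divide_left)
  have "(A + a) * (f y' - f xs) = A * (f y - f xs) + (A * (f y' - f y) + a * (f y' - f xs))"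
    by (simp add: algebra_simps)
  moreover define X Y Z where "X = A' / lam * ((norm (lam *\<^sub>R g + (y' - xt)))\<^sup>2 - (norm (y' - xt))\<^sup>2) / 2"
    and "Y = (1 - (1 - eta)\<^sup>2) * (A' / lam * (norm (y' - xt))\<^sup>2) / 2" and "Z = a\<^sup>2 / 2 * (norm g)\<^sup>2"
  ultimately show ?thesis using 1 2 3 4
    unfolding A'_def[symmetric] X_def[symmetric] Y_def[symmetric] Z_def[symmetric] by linarith
qed

text \<open>From \<open>1 / 2 \<le> eta \<le> 1\<close> the loss factor
  \<open>1 - (1 - eta)\<^sup>2\<close> is at least 3/4, and half of it is 3/8. The second conclusion
  is \<open>1 / 2 \<le> eta\<close> solved for \<open>lam * r ^ (p - 1)\<close>.\<close>

lemma atd_step_potential: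
  assumes pair: "atd_pair p L f A x y lam y'" and "0 \<le> A" and g: "GDERIV f y' :> g" and a: "a = step_size lam A"
  defines "r \<equiv> norm (y' - extrapolation A x y lam)"
  shows "(A + a) * (f y' - f xs) + (norm (x - a *\<^sub>R g - xs))\<^sup>2 / 2 + 3 / 8 * ((A + a) / lam * r\<^sup>2)
       \<le> A * (f y - f xs) + (norm (x - xs))\<^sup>2 / 2"
    and "fact (p - 1) / (2 * L) \<le> lam * r ^ (p - 1)" and "0 < lam"
proof -
  define eta where "eta = lam * (L * r ^ (p - 1) / fact (p - 1))"
  have *: "0 < lam" "1 / 2 \<le> eta" "eta \<le> real p / (real p + 1)"
    "is_arg_min (model (extrapolation A x y lam)) (\<lambda>_. True) y'"
    using pair unfolding atd_pair_def Let_def eta_def r_def reg_taylor_eq by auto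
  show "0 < lam" by fact
  have A': "A + a > 0" using step_size_props[OF *(1) \<open>0 \<le> A\<close>] a \<open>0 \<le> A\<close> by simp
  have eta1: "eta \<le> 1" using *(3) by (rule order_trans) simp
  have "(1 - eta)\<^sup>2 \<le> (1 / 2)\<^sup>2" using *(2) eta1 by (intro power_mono) auto
  then have "3 / 4 * ((A + a) / lam * r\<^sup>2) \<le> (1 - (1 - eta)\<^sup>2) * ((A + a) / lam * r\<^sup>2)"
    using A' *(1) by (intro mult_right_mono) (auto simp: power2_eq_square)
  moreover have "eta = lam * (L * norm (y' - extrapolation A x y lam) ^ (p - 1) / fact (p - 1))"
    by (simp only: eta_def r_def)
  note potential_step[OF *(1) \<open>0 \<le> A\<close> refl a *(4) g this *(3), folded r_def]
  moreover define X where "X = (A + a) / lam * r\<^sup>2"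
  moreover define Y where "Y = (1 - (1 - eta)\<^sup>2) * X"
  ultimately show "(A + a) * (f y' - f xs) + (norm (x - a *\<^sub>R g - xs))\<^sup>2 / 2 + 3 / 8 * ((A + a) / lam * r\<^sup>2)
       \<le> A * (f y - f xs) + (norm (x - xs))\<^sup>2 / 2"
    unfolding X_def[symmetric] Y_def[symmetric] by linarith
  show "fact (p - 1) / (2 * L) \<le> lam * r ^ (p - 1)"
    using *(2) L0 by (simp add: eta_def field_simps)
qed

text \<open>The bound on \<open>y\<close> confines the search for the next iterate to a ball of
  known radius. It persists because the loss in the potential controls \<open>A' * r\<close> by
  \<open>2 * a * norm xs\<close>: then \<open>A' *\<^sub>R (y' - xs)\<close> has norm at most
  \<open>(2 * a + 3 * A + a) * norm xs\<close>.\<close>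

lemma atd_invariant:
  assumes "atd p L f k A x y"
  shows "0 \<le> A \<and> A * (f y - f xs) + (norm (x - xs))\<^sup>2 / 2 \<le> (norm xs)\<^sup>2 / 2 \<and> norm (y - xs) \<le> 3 * norm xs"
  using assms
proof induction
  case init
  then show ?case by simp
next
  case (step k A x y lam y' a g)
  then have A: "0 \<le> A" and pot: "A * (f y - f xs) + (norm (x - xs))\<^sup>2 / 2 \<le> (norm xs)\<^sup>2 / 2"
    and y: "norm (y - xs) \<le> 3 * norm xs" by auto
  define xt where "xt = extrapolation A x y lam"
  define r where "r = norm (y' - xt)"
  note st = atd_step_potential[OF step.hyps(2) A step.hyps(4,3), folded xt_def, folded r_def]
  note ss = step_size_props[OF st(3) A, folded step.hyps(3)]
  define A' where "A' = A + a"
  have A': "A' > 0" using A ss by (simp add: A'_def)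
  have fy': "0 \<le> A' * (f y' - f xs)" using f_min A' by simp
  have "0 \<le> A' / lam * r\<^sup>2" using A' st(3) by simp
  have nx: "norm (x - xs) \<le> norm xs"
  proof -
    have "0 \<le> A * (f y - f xs)" using f_min A by simp
    then have "(norm (x - xs))\<^sup>2 \<le> (norm xs)\<^sup>2" using pot by linarith
    then show ?thesis by (rule power2_le_imp_le) simp
  qed
  have "3 / 8 * (A' / lam * r\<^sup>2) \<le> (norm xs)\<^sup>2 / 2"
  proof -
    define X where "X = A' / lam * r\<^sup>2"
    show ?thesis
      using st(1) pot fy' zero_le_power2[of "norm (x - a *\<^sub>R g - xs)"]
      unfolding A'_def[symmetric] X_def[symmetric] by linarith
  qed
  then have "A' * r\<^sup>2 * 3 \<le> 4 * (norm xs)\<^sup>2 * lam" using st(3) by (simp add: field_simps)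
  moreover have "0 \<le> A' * r\<^sup>2" using A' by simp
  ultimately have "A' * r\<^sup>2 \<le> 4 * (norm xs)\<^sup>2 * lam" by linarith
  then have "A' * (A' * r\<^sup>2) \<le> A' * (4 * (norm xs)\<^sup>2 * lam)" using A' by simp
  also have "\<dots> = 4 * (norm xs)\<^sup>2 * a\<^sup>2" using ss(3) by (simp add: A'_def)
  finally have "(A' * r)\<^sup>2 \<le> (2 * a * norm xs)\<^sup>2" by (simp add: power2_eq_square mult_ac)
  then have Ar: "A' * r \<le> 2 * a * norm xs"
    by (rule power2_le_imp_le) (use ss in simp)
  have ext: "A' *\<^sub>R xt = A *\<^sub>R y + a *\<^sub>R x"
    using A' unfolding xt_def extrapolation_def Let_def step.hyps(3)[symmetric] A'_def[symmetric]
    by (simp add: scaleR_add_right)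
  have "A' *\<^sub>R (y' - xt) + A *\<^sub>R (y - xs) + a *\<^sub>R (x - xs) = A' *\<^sub>R y' - A' *\<^sub>R xt + (A *\<^sub>R y + a *\<^sub>R x) - A' *\<^sub>R xs"
    by (simp add: A'_def algebra_simps)
  then have "A' *\<^sub>R (y' - xs) = A' *\<^sub>R (y' - xt) + A *\<^sub>R (y - xs) + a *\<^sub>R (x - xs)"
    unfolding ext[symmetric] by (simp add: scaleR_diff_right)
  then have "norm (A' *\<^sub>R (y' - xs)) \<le> norm (A' *\<^sub>R (y' - xt)) + norm (A *\<^sub>R (y - xs)) + norm (a *\<^sub>R (x - xs))"
    by (simp only:) (rule order_trans[OF norm_triangle_ineq add_right_mono[OF norm_triangle_ineq]])
  then have "A' * norm (y' - xs) \<le> A' * r + A * norm (y - xs) + a * norm (x - xs)"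
    using A' A ss by (simp add: r_def)
  also have "\<dots> \<le> 2 * a * norm xs + A * (3 * norm xs) + a * norm xs"
    using Ar A ss y nx by (intro add_mono mult_left_mono) auto
  also have "\<dots> = A' * (3 * norm xs)" by (simp add: A'_def algebra_simps)
  finally have "norm (y' - xs) \<le> 3 * norm xs" using A' by (subst (asm) mult_le_cancel_left_pos)
  moreover have "(A + a) * (f y' - f xs) + (norm (x - a *\<^sub>R g - xs))\<^sup>2 / 2 \<le> (norm xs)\<^sup>2 / 2"
  proof -
    define X where "X = A' / lam * r\<^sup>2"
    show ?thesis
      using st(1) pot \<open>0 \<le> A' / lam * r\<^sup>2\<close> unfolding A'_def[symmetric] X_def[symmetric] by linarith
  qed
  ultimately show ?case using A' A'_def by auto
qed

lemma atd_accuracy: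
  assumes "atd p L f k A x y" "0 < A"
  shows "f y - f xs \<le> (norm xs)\<^sup>2 / (2 * A)"
proof -
  have "A * (f y - f xs) \<le> (norm xs)\<^sup>2 / 2"
    using atd_invariant[OF assms(1)] zero_le_power2[of "norm (x - xs)"] by linarith
  then show ?thesis using assms(2) by (simp add: field_simps)
qed

text \<open>At \<open>p = 1\<close> the exponent \<open>s\<close> of \<open>atd_growth\<close> would
  be 0. Here \<open>r ^ 0 = 1\<close>, so the admissibility condition bounds \<open>lam\<close>
  below directly and \<open>sqrt A\<close> grows linearly.\<close>

lemma atd_growth_p1:
  assumes "atd p L f k A x y" "p = 1"
  shows "0 \<le> A \<and> real k / 2 * sqrt (1 / (2 * L)) \<le> sqrt A"
  using assms(1)
proof induction
  case (step k A x y lam y' a g)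
  then have A: "0 \<le> A" by simp
  note st = atd_step_potential[OF step.hyps(2) A step.hyps(4,3)]
  note ss = step_size_props[OF st(3) A, folded step.hyps(3)]
  define q where "q = sqrt (1 / (2 * L))"
  have "q \<le> sqrt lam" using st(2) assms(2) by (simp add: q_def)
  moreover have "real k / 2 * q \<le> sqrt A" using step.IH by (simp add: q_def)
  moreover have "real (Suc k) / 2 * q = real k / 2 * q + q / 2" by (simp add: field_simps)
  ultimately have "real (Suc k) / 2 * q \<le> sqrt (A + a)" using ss(4) by linarith
  then show ?case using ss A by (simp add: q_def)
qed simp


text \<open>\<open>U\<close> and \<open>V\<close> bound the sums of \<open>A\<^sub>i / \<lambda>\<^sub>i * r\<^sub>i\<^sup>2\<close> and of \<open>sqrt \<lambda>\<^sub>i\<close>. The exponent \<open>s\<close> is the one for which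
  \<open>\<lambda>\<^sub>i\<close> cancels from the summands of their weighted geometric mean \<open>w\<close>; since \<open>w\<close> is superadditive,
  this is Hoelder's inequality one step at a time. It gives the discrete differential
  inequality \<open>w' - w \<ge> c * w' powr \<beta>\<close>, hence linear growth of \<open>w powr (1 - \<beta>) = w powr \<gamma>\<close>.\<close>

lemma atd_growth:
  assumes "atd p L f k A x y" "2 \<le> p"
  defines "n \<equiv> 3 * real p + 1" and "s \<equiv> (real p - 1) / (3 * real p + 1)"
    and "\<gamma> \<equiv> 2 / (real p + 1)" and "\<beta> \<equiv> (real p - 1) / (real p + 1)"
    and "\<kappa> \<equiv> (fact (p - 1) / (2 * L)) powr (2 / (3 * real p + 1))" and "D \<equiv> 2 * (norm xs)\<^sup>2 powr ((real p - 1) / (3 * real p + 1))"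
  shows "\<exists>U V. 0 \<le> U \<and> 0 \<le> V \<and> (1 \<le> k \<longrightarrow> 0 < A \<and> 0 < norm xs) \<and> 0 \<le> A \<and>
      A * (f y - f xs) + (norm (x - xs))\<^sup>2 / 2 + 3 / 8 * U \<le> (norm xs)\<^sup>2 / 2 \<and> V \<le> 2 * sqrt A \<and>
      real k * (\<gamma> * \<kappa> * D powr (- \<beta>)) \<le> (U powr s * V powr (1 - s)) powr \<gamma>"
  using assms(1)
proof induction
  case init
  show ?case by (intro exI[of _ 0]) simp
next
  case (step k A x y lam y' a g)
  then obtain U V where U: "0 \<le> U" and V: "0 \<le> V" and A: "0 \<le> A"
    and pot: "A * (f y - f xs) + (norm (x - xs))\<^sup>2 / 2 + 3 / 8 * U \<le> (norm xs)\<^sup>2 / 2" and VA: "V \<le> 2 * sqrt A"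
    and W: "real k * (\<gamma> * \<kappa> * D powr (- \<beta>)) \<le> (U powr s * V powr (1 - s)) powr \<gamma>" by blast
  define xt where "xt = extrapolation A x y lam"
  define r where "r = norm (y' - xt)"
  note st = atd_step_potential[OF step.hyps(2) A step.hyps(4,3), folded xt_def, folded r_def]
  note ss = step_size_props[OF st(3) A, folded step.hyps(3)]
  define A' where "A' = A + a"
  have A': "A' > 0" using A ss by (simp add: A'_def)
  define u v where "u = A' / lam * r\<^sup>2" and "v = sqrt lam"
  define U' V' where "U' = U + u" and "V' = V + v"
  have s: "0 < s" "s < 1" using assms(2) by (auto simp: s_def divide_less_eq)
  have \<gamma>: "0 < \<gamma>" "\<gamma> < 1" using assms(2) by (auto simp: \<gamma>_def)
  have "0 < fact (p - 1) / (2 * L)" using L0 by simp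
  then have "0 < lam * r ^ (p - 1)" using st(2) by linarith
  then have "r \<noteq> 0" using assms(2) by (auto simp: power_0_left)
  then have r: "r > 0" by (simp add: r_def)
  have u: "u > 0" using A' st(3) r by (simp add: u_def)
  have v: "v > 0" using st(3) by (simp add: v_def)
  have pot': "A' * (f y' - f xs) + (norm (x - a *\<^sub>R g - xs))\<^sup>2 / 2 + 3 / 8 * U' \<le> (norm xs)\<^sup>2 / 2"
    using add_mono[OF st(1) pot] unfolding A'_def[symmetric] u_def[symmetric] U'_def distrib_left
    by (simp only: add_ac add_le_cancel_left add_le_cancel_right)
  have V'A: "V' \<le> 2 * sqrt A'" using VA ss(4) by (simp add: V'_def v_def A'_def)
  have U'R: "U' \<le> 2 * (norm xs)\<^sup>2"
  proof -
    have "0 \<le> A' * (f y' - f xs)" using f_min A' by simp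
    then have "3 / 8 * U' \<le> (norm xs)\<^sup>2 / 2" using pot' zero_le_power2[of "norm (x - a *\<^sub>R g - xs)"] by linarith
    then show ?thesis using zero_le_power2[of "norm xs"] by linarith
  qed
  have U'0: "U' > 0" using U u by (simp add: U'_def)
  have V'0: "V' > 0" using V v by (simp add: V'_def)
  have R: "0 < (norm xs)\<^sup>2" using U'R U'0 by linarith
  define w w' where "w = U powr s * V powr (1 - s)" and "w' = U' powr s * V' powr (1 - s)"
  have w': "w' > 0" using U'0 V'0 by (simp add: w'_def)
  \<comment> \<open>The exponents are such that \<open>u powr s * v powr (1 - s)\<close> equals
    \<open>A' powr s\<close> times a power of \<open>lam * r ^ (p - 1)\<close>, which admissibility
    bounds below.\<close>
  have uv: "\<kappa> * A' powr s \<le> u powr s * v powr (1 - s)"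
  proof -
    have "\<kappa> \<le> (lam * r ^ (p - 1)) powr (2 / n)"
      unfolding \<kappa>_def n_def using st(2) L0 by (intro powr_mono2) auto
    also have "\<dots> = lam powr (2 / n) * r powr (real (p - 1) * (2 / n))"
      using st(3) r by (simp add: powr_mult powr_powr flip: powr_realpow)
    also have "real (p - 1) * (2 / n) = 2 * s" using p1 by (simp add: s_def n_def of_nat_diff)
    finally have "\<kappa> * A' powr s \<le> lam powr (2 / n) * r powr (2 * s) * A' powr s"
      by (intro mult_right_mono) auto
    also have "\<dots> = u powr s * v powr (1 - s)"
    proof -
      have "u powr s = A' powr s * lam powr (- s) * r powr (2 * s)"
        using A' st(3) r by (simp add: u_def powr_mult powr_divide powr_minus_divide powr_powr flip: powr_numeral)
      moreover have "v powr (1 - s) = lam powr ((1 - s) / 2)"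
        using st(3) by (simp add: v_def powr_powr flip: powr_half_sqrt)
      moreover have "lam powr (- s) * lam powr ((1 - s) / 2) = lam powr (2 / n)"
      proof -
        have "1 - 3 * s = 4 / n" unfolding s_def n_def by (simp add: field_simps)
        then have "(1 - 3 * s) / 2 = 2 / n" by (simp only:) simp
        then have "- s + (1 - s) / 2 = 2 / n" by argo
        then show ?thesis by (simp only: powr_add[symmetric])
      qed
      ultimately show ?thesis by (simp add: mult_ac)
    qed
    finally show ?thesis .
  qed
  have ww: "w + \<kappa> * A' powr s \<le> w'"
    using geometric_mean_superadditive[OF U less_imp_le[OF u] V less_imp_le[OF v] s] uv
    unfolding w_def w'_def U'_def V'_def by linarith
  have D: "D > 0" using R by (simp add: D_def)
  have w'D: "w' \<le> D * A' powr ((1 - s) / 2)"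
  proof -
    have "w' \<le> (2 * (norm xs)\<^sup>2) powr s * (2 * sqrt A') powr (1 - s)"
      unfolding w'_def using U'R V'A U'0 V'0 s by (intro mult_mono powr_mono2) auto
    also have "\<dots> = (2 powr s * 2 powr (1 - s)) * (norm xs)\<^sup>2 powr s * A' powr ((1 - s) / 2)"
      using A' by (simp add: powr_mult powr_powr flip: powr_half_sqrt)
    also have "2 powr s * 2 powr (1 - s) = (2::real)" by (simp flip: powr_add)
    finally show ?thesis by (simp add: D_def s_def)
  qed
  \<comment> \<open>Eliminates \<open>A'\<close> in favour of \<open>w'\<close>;
    \<open>\<beta>\<close> solves \<open>(1 - s) / 2 * \<beta> = s\<close>.\<close>
  have inc: "D powr (- \<beta>) * w' powr \<beta> \<le> A' powr s"
  proof -
    have "w' / D \<le> A' powr ((1 - s) / 2)" using w'D D by (simp add: field_simps)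
    then have "(w' / D) powr \<beta> \<le> (A' powr ((1 - s) / 2)) powr \<beta>"
      using w' D p1 by (intro powr_mono2) (auto simp: \<beta>_def)
    also have "\<dots> = A' powr s"
    proof -
      have "1 - s = 2 * (real p + 1) / n" unfolding s_def n_def by (simp add: field_simps)
      moreover have cancel: "2 * P / N / 2 * (Q / P) = Q / N" if "P \<noteq> 0" for P Q N :: real using that by simp
      have "real p + 1 \<noteq> 0" by (simp add: add_nonneg_eq_0_iff)
      from cancel[OF this, of n "real p - 1"] have "2 * (real p + 1) / n / 2 * \<beta> = s"
        by (simp only: \<beta>_def s_def n_def)
      ultimately have "(1 - s) / 2 * \<beta> = s" by (simp only:)
      then show ?thesis by (simp only: powr_powr)
    qed
    finally show ?thesis using w' D by (simp add: powr_divide powr_minus_divide)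
  qed
  have "w powr \<gamma> + \<gamma> * w' powr (\<gamma> - 1) * (w' - w) \<le> w' powr \<gamma>"
    by (rule powr_increment_ge[OF _ w' \<gamma>]) (simp add: w_def)
  moreover have "\<gamma> * \<kappa> * D powr (- \<beta>) \<le> \<gamma> * w' powr (\<gamma> - 1) * (w' - w)"
  proof -
    \<comment> \<open>This relation makes the powers of \<open>w'\<close> cancel, so that each
      iteration adds the same amount.\<close>
    have "\<beta> + \<gamma> = 1"
      unfolding \<beta>_def \<gamma>_def add_divide_distrib[symmetric] by (simp add: add_nonneg_eq_0_iff)
    then have "\<gamma> - 1 + \<beta> = 0" by simp
    then have one: "w' powr (\<gamma> - 1) * w' powr \<beta> = 1" using w' by (simp only: powr_add[symmetric]) simp
    have "\<gamma> * w' powr (\<gamma> - 1) * (\<kappa> * (D powr (- \<beta>) * w' powr \<beta>))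
      = \<gamma> * \<kappa> * D powr (- \<beta>) * (w' powr (\<gamma> - 1) * w' powr \<beta>)"
      by (simp only: mult_ac)
    then have "\<gamma> * \<kappa> * D powr (- \<beta>) = \<gamma> * w' powr (\<gamma> - 1) * (\<kappa> * (D powr (- \<beta>) * w' powr \<beta>))"
      unfolding one by simp
    also have "\<dots> \<le> \<gamma> * w' powr (\<gamma> - 1) * (\<kappa> * A' powr s)"
      using inc \<gamma> by (intro mult_left_mono) (auto simp: \<kappa>_def)
    also have "\<dots> \<le> \<gamma> * w' powr (\<gamma> - 1) * (w' - w)"
      using ww \<gamma> by (intro mult_left_mono) auto
    finally show ?thesis .
  qed
  ultimately have "real (Suc k) * (\<gamma> * \<kappa> * D powr (- \<beta>)) \<le> w' powr \<gamma>"
    using W unfolding w_def[symmetric] by (simp add: algebra_simps)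
  then have "real (Suc k) * (\<gamma> * \<kappa> * D powr (- \<beta>)) \<le> (U' powr s * V' powr (1 - s)) powr \<gamma>"
    by (simp only: w'_def)
  moreover have "0 \<le> U'" "0 \<le> V'" "0 \<le> A'" "0 < norm xs" using U'0 V'0 A' R by simp_all
  ultimately show ?case
    unfolding A'_def[symmetric] using A' pot' V'A
    by (intro exI[of _ U'] exI[of _ V'] conjI impI)
qed

text \<open>Insert \<open>w \<le> D * A powr ((1 - s) / 2)\<close> into the linear growth of
  \<open>w powr \<gamma>\<close> and raise to the power \<open>n / 2\<close>, which turns the
  exponent of \<open>A\<close> into 1.\<close>

lemma atd_growth_bound:
  assumes "atd p L f k A x y" "2 \<le> p" "1 \<le> k"
  shows "0 < A" "0 < norm xs" "(real k / (real p + 1)) powr ((3 * real p + 1) / 2) * fact (p - 1) / (2 * L * norm xs ^ (p - 1)) \<le> A"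
proof -
  define n s \<gamma> \<beta> \<kappa> D where defs: "n = 3 * real p + 1" "s = (real p - 1) / (3 * real p + 1)"
    "\<gamma> = 2 / (real p + 1)" "\<beta> = (real p - 1) / (real p + 1)"
    "\<kappa> = (fact (p - 1) / (2 * L)) powr (2 / (3 * real p + 1))" "D = 2 * (norm xs)\<^sup>2 powr ((real p - 1) / (3 * real p + 1))"
  from atd_growth[OF assms(1,2), folded defs] obtain U V where U: "0 \<le> U" and V: "0 \<le> V" and A: "0 < A" and R: "0 < norm xs"
    and pot: "A * (f y - f xs) + (norm (x - xs))\<^sup>2 / 2 + 3 / 8 * U \<le> (norm xs)\<^sup>2 / 2" and VA: "V \<le> 2 * sqrt A"
    and W: "real k * (\<gamma> * \<kappa> * D powr (- \<beta>)) \<le> (U powr s * V powr (1 - s)) powr \<gamma>" using assms(3) by auto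
  show "0 < A" "0 < norm xs" by fact+
  have s: "0 < s" "s < 1" using assms(2) by (auto simp: defs divide_less_eq)
  have D: "D > 0" using R by (simp add: defs)
  have \<kappa>: "\<kappa> > 0" using L0 by (simp add: defs)
  have \<gamma>: "\<gamma> > 0" using assms(2) by (simp add: defs)
  define w where "w = U powr s * V powr (1 - s)"
  have UR: "U \<le> 2 * (norm xs)\<^sup>2"
  proof -
    have "0 \<le> A * (f y - f xs)" using f_min A by simp
    then have "3 / 8 * U \<le> (norm xs)\<^sup>2 / 2" using pot zero_le_power2[of "norm (x - xs)"] by linarith
    then show ?thesis using zero_le_power2[of "norm xs"] by linarith
  qed
  have wD: "w \<le> D * A powr ((1 - s) / 2)"
  proof -
    have "w \<le> (2 * (norm xs)\<^sup>2) powr s * (2 * sqrt A) powr (1 - s)"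
      unfolding w_def using UR VA U V s by (intro mult_mono powr_mono2) auto
    also have "\<dots> = (2 powr s * 2 powr (1 - s)) * (norm xs)\<^sup>2 powr s * A powr ((1 - s) / 2)"
      using A by (simp add: powr_mult powr_powr flip: powr_half_sqrt)
    also have "2 powr s * 2 powr (1 - s) = (2::real)" by (simp flip: powr_add)
    finally show ?thesis by (simp add: defs)
  qed
  have "n > 0" by (simp add: defs)
  have "1 - s = 2 * (real p + 1) / n" unfolding defs by (simp add: field_simps)
  then have e1: "(1 - s) / 2 * \<gamma> * (n / 2) = 1" using \<open>n > 0\<close> by (simp add: defs(3) add_nonneg_eq_0_iff)
  have e2: "\<beta> + \<gamma> = 1" unfolding defs add_divide_distrib[symmetric] by (simp add: add_nonneg_eq_0_iff)
  have "real k * (\<gamma> * \<kappa> * D powr (- \<beta>)) \<le> (D * A powr ((1 - s) / 2)) powr \<gamma>"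
    using W wD \<gamma> unfolding w_def[symmetric] by (elim order_trans) (intro powr_mono2, auto simp: w_def)
  also have "\<dots> = D powr \<gamma> * A powr ((1 - s) / 2 * \<gamma>)"
    using D by (simp add: powr_mult powr_powr)
  finally have "(real k * (\<gamma> * \<kappa> * D powr (- \<beta>))) * D powr (- \<gamma>) \<le> (D powr \<gamma> * A powr ((1 - s) / 2 * \<gamma>)) * D powr (- \<gamma>)"
    by (intro mult_right_mono) auto
  also have "\<dots> = A powr ((1 - s) / 2 * \<gamma>)" using D by (simp add: powr_minus)
  also have "(real k * (\<gamma> * \<kappa> * D powr (- \<beta>))) * D powr (- \<gamma>) = real k * \<gamma> * \<kappa> / D"
  proof -
    have "D powr (- \<beta>) * D powr (- \<gamma>) = D powr (- (\<beta> + \<gamma>))" by (simp flip: powr_add)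
    then show ?thesis unfolding e2 using D by (simp add: powr_minus_divide mult.assoc)
  qed
  finally have "(real k * \<gamma> * \<kappa> / D) powr (n / 2) \<le> (A powr ((1 - s) / 2 * \<gamma>)) powr (n / 2)"
    using \<gamma> \<kappa> D by (intro powr_mono2) (auto simp: defs)
  also have "\<dots> = A" using A by (simp only: powr_powr e1) simp
  also have "(real k * \<gamma> * \<kappa> / D) powr (n / 2) = (real k / (real p + 1)) powr (n / 2) * fact (p - 1) / (2 * L * norm xs ^ (p - 1))"
  proof -
    have "real k * \<gamma> * \<kappa> / D = (real k / (real p + 1)) * \<kappa> / (norm xs powr (2 * s))"
      using R by (simp add: defs powr_powr flip: powr_numeral)
    moreover have "\<kappa> powr (n / 2) = fact (p - 1) / (2 * L)"
      using L0 unfolding defs by (simp add: powr_powr)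
    moreover have "(norm xs powr (2 * s)) powr (n / 2) = norm xs ^ (p - 1)"
    proof -
      have "2 * s * (n / 2) = real (p - 1)" using p1 by (simp add: defs)
      then show ?thesis using R by (simp add: powr_powr powr_realpow)
    qed
    ultimately show ?thesis using \<kappa> R by (simp add: powr_mult powr_divide)
  qed
  finally show "(real k / (real p + 1)) powr ((3 * real p + 1) / 2) * fact (p - 1) / (2 * L * norm xs ^ (p - 1)) \<le> A"
    by (simp add: defs)
qed

theorem atd_rate:
  assumes "atd p L f k A x y" "1 \<le> k"
  shows "f y - f xs \<le> atd_const p * L * norm xs ^ (p + 1) / real k powr ((3 * real p + 1) / 2)"
proof -
  define Q where "Q = (real k / (real p + 1)) powr ((3 * real p + 1) / 2)"
  have Q: "Q > 0" using assms(2) by (simp add: Q_def)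
  have key: "f y - f xs \<le> L * norm xs ^ (p + 1) / (fact (p - 1) * Q)"
  proof (cases "p = 1")
    case True
    then have "Q = (real k / 2)\<^sup>2" using assms(2) by (simp add: Q_def powr_numeral)
    moreover have "0 \<le> A" and "real k / 2 * sqrt (1 / (2 * L)) \<le> sqrt A"
      using atd_growth_p1[OF assms(1) True] by auto
    then have "(real k / 2 * sqrt (1 / (2 * L)))\<^sup>2 \<le> (sqrt A)\<^sup>2"
      using L0 by (intro power_mono) auto
    moreover have "(real k / 2 * sqrt (1 / (2 * L)))\<^sup>2 = (real k / 2)\<^sup>2 * (1 / (2 * L))"
      using L0 by (simp only: power_mult_distrib) simp
    ultimately have QA: "Q / (2 * L) \<le> A" using \<open>0 \<le> A\<close> by simp
    moreover have "0 < Q / (2 * L)" using Q L0 by simp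
    ultimately have "f y - f xs \<le> (norm xs)\<^sup>2 / (2 * A)" by (intro atd_accuracy[OF assms(1)]) linarith
    also have "\<dots> \<le> (norm xs)\<^sup>2 / (2 * (Q / (2 * L)))"
    proof (intro divide_left_mono)
      show "0 < 2 * A * (2 * (Q / (2 * L)))"
        using order_less_le_trans[OF \<open>0 < Q / (2 * L)\<close> QA] \<open>0 < Q / (2 * L)\<close> by (intro mult_pos_pos) auto
    qed (use QA in auto)
    finally show ?thesis using True by (simp add: power2_eq_square mult_ac)
  next
    case False
    then have p2: "2 \<le> p" using p1 by simp
    note gr = atd_growth_bound[OF assms(1) p2 assms(2), folded Q_def]
    define B where "B = Q * fact (p - 1) / (2 * L * norm xs ^ (p - 1))"
    have B: "B > 0" using Q L0 gr(2) by (simp add: B_def)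
    have "f y - f xs \<le> (norm xs)\<^sup>2 / (2 * A)" by (rule atd_accuracy[OF assms(1) gr(1)])
    also have "\<dots> \<le> (norm xs)\<^sup>2 / (2 * B)"
    proof (intro divide_left_mono)
      show "0 < 2 * A * (2 * B)" using gr(1) B by simp
      show "2 * B \<le> 2 * A" using gr(3) by (simp add: B_def)
    qed simp
    also have "\<dots> = L * ((norm xs)\<^sup>2 * norm xs ^ (p - 1)) / (fact (p - 1) * Q)"
      using L0 gr(2) by (simp add: B_def mult_ac)
    also have "(norm xs)\<^sup>2 * norm xs ^ (p - 1) = norm xs ^ (p + 1)"
      using p2 by (simp flip: power_add)
    finally show ?thesis .
  qed
  \<comment> \<open>The bound in \<open>key\<close> is sharper than the one with
    \<open>atd_const p\<close> by the factor \<open>2 ^ (p - 1)\<close>.\<close>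
  also have "\<dots> \<le> 2 ^ (p - 1) * (L * norm xs ^ (p + 1) / (fact (p - 1) * Q))"
    using mult_right_mono[of 1 "2 ^ (p - 1)" "L * norm xs ^ (p + 1) / (fact (p - 1) * Q)"] L0 Q by simp
  also have "\<dots> = atd_const p * L * norm xs ^ (p + 1) / real k powr ((3 * real p + 1) / 2)"
    by (simp add: Q_def atd_const_def powr_divide)
  finally show ?thesis .
qed

end

section \<open>Query complexity\<close>

lemma step_size_mono:
  assumes "0 \<le> A" "0 \<le> lam1" "lam1 \<le> lam2"
  shows "step_size lam1 A \<le> step_size lam2 A"
  unfolding step_size_def using assms
  by (intro divide_right_mono add_mono real_sqrt_le_mono power_mono mult_right_mono mult_left_mono) auto

lemma extrapolation_eq:
  fixes x y :: "'a::euclidean_space"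
  assumes "0 \<le> A" "0 < lam"
  shows "extrapolation A x y lam = x + (A / (A + step_size lam A)) *\<^sub>R (y - x)"
proof -
  define a where "a = step_size lam A"
  have "a > 0" using step_size_props(2)[OF assms(2,1)] by (simp add: a_def)
  then have "A + a \<noteq> 0" using assms by linarith
  then have "a / (A + a) = 1 - A / (A + a)" by (simp add: field_simps)
  then show ?thesis
    unfolding extrapolation_def Let_def a_def[symmetric] by (simp only:) (simp add: algebra_simps)
qed

text \<open>The weight of \<open>y\<close> changes by \<open>A * (a2 - a1) / (B1 * B2)\<close>.
  Writing \<open>lam = a\<^sup>2 / (A + a)\<close> at both ends, \<open>lam2 - lam1\<close> has the
  same factor \<open>(a2 - a1) / (B1 * B2)\<close>, multiplied by something at least
  \<open>lam1 * A\<close>.\<close>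

lemma extrapolation_lipschitz:
  fixes x y :: "'a::euclidean_space"
  assumes "0 \<le> A" "0 < lam1" "lam1 \<le> lam2"
  shows "lam1 * norm (extrapolation A x y lam2 - extrapolation A x y lam1) \<le> (lam2 - lam1) * norm (y - x)"
proof -
  define a1 a2 where a_def: "a1 = step_size lam1 A" "a2 = step_size lam2 A"
  have a: "0 < a1" "a1 \<le> a2" "a1\<^sup>2 = lam1 * (A + a1)" "a2\<^sup>2 = lam2 * (A + a2)"
    using step_size_props[OF assms(2,1)] step_size_props[of lam2 A] step_size_mono[of A lam1 lam2] assms
    by (auto simp: a_def)
  define B1 B2 where B: "B1 = A + a1" "B2 = A + a2"
  have pos: "0 < B1" "0 < B2" using a assms by (auto simp: B)
  have lam: "lam1 = a1\<^sup>2 / B1" "lam2 = a2\<^sup>2 / B2" using a pos by (auto simp: B field_simps)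
  have "norm (extrapolation A x y lam2 - extrapolation A x y lam1) = \<bar>A / B2 - A / B1\<bar> * norm (y - x)"
    using assms by (simp add: extrapolation_eq a_def[symmetric] B[symmetric] scaleR_left_diff_distrib[symmetric])
  also have "\<bar>A / B2 - A / B1\<bar> = A * (a2 - a1) / (B1 * B2)"
  proof -
    have "A / B1 - A / B2 = A * (a2 - a1) / (B1 * B2)" using pos by (simp add: field_simps B)
    moreover have "0 \<le> A * (a2 - a1) / (B1 * B2)" using pos a assms by simp
    ultimately show ?thesis by linarith
  qed
  finally have n: "norm (extrapolation A x y lam2 - extrapolation A x y lam1) = A * (a2 - a1) / (B1 * B2) * norm (y - x)" .
  have "lam1 \<le> a1" using step_size_props(1)[OF assms(2,1)] by (simp add: a_def)
  then have "lam1 * A \<le> a1 * A" using assms by (simp add: mult_right_mono)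
  moreover have "0 \<le> a1 * a2" "0 \<le> A * a2" using a assms by simp_all
  ultimately have "lam1 * A \<le> a1 * a2 + A * (a1 + a2)" by (simp add: algebra_simps)
  then have "(lam1 * A) * ((a2 - a1) / (B1 * B2)) \<le> (a1 * a2 + A * (a1 + a2)) * ((a2 - a1) / (B1 * B2))"
    using a pos by (intro mult_right_mono) auto
  also have "\<dots> = lam2 - lam1"
  proof -
    have "lam2 - lam1 = (a2\<^sup>2 * B1 - a1\<^sup>2 * B2) / (B1 * B2)" using pos by (simp add: lam field_simps)
    also have "a2\<^sup>2 * B1 - a1\<^sup>2 * B2 = (a1 * a2 + A * (a1 + a2)) * (a2 - a1)"
      by (simp add: B power2_eq_square algebra_simps)
    finally show ?thesis by simp
  qed
  finally have "lam1 * (A * (a2 - a1) / (B1 * B2)) \<le> lam2 - lam1" by (simp add: mult.assoc)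
  then have "lam1 * (A * (a2 - a1) / (B1 * B2)) * norm (y - x) \<le> (lam2 - lam1) * norm (y - x)"
    by (rule mult_right_mono) simp
  then show ?thesis unfolding n by (simp add: mult.assoc)
qed

lemma norm_extrapolation_le:
  fixes x y z :: "'a::euclidean_space"
  assumes "0 \<le> A" "0 < lam" "norm (x - z) \<le> D" "norm (y - z) \<le> D"
  shows "norm (extrapolation A x y lam - z) \<le> D"
proof -
  define t where "t = A / (A + step_size lam A)"
  have t: "0 \<le> t" "t \<le> 1" using assms step_size_props(2)[OF assms(2,1)] by (auto simp: t_def divide_le_eq)
  have "extrapolation A x y lam - z = (1 - t) *\<^sub>R (x - z) + t *\<^sub>R (y - z)"
    using assms by (simp add: extrapolation_eq t_def[symmetric] algebra_simps)
  also have "norm \<dots> \<le> (1 - t) * norm (x - z) + t * norm (y - z)"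
    using t norm_triangle_ineq[of "(1 - t) *\<^sub>R (x - z)" "t *\<^sub>R (y - z)"] by simp
  also have "\<dots> \<le> (1 - t) * D + t * D" using t assms by (intro add_mono mult_left_mono) auto
  finally show ?thesis by (simp add: algebra_simps)
qed

section \<open>The search procedure\<close>

text \<open>Depends on \<open>f\<close> only through the oracle answer \<open>P\<close>; exact
  minimisation counts as free computation.\<close>

definition model_minimizer :: "nat \<Rightarrow> real \<Rightarrow> ('a::euclidean_space \<Rightarrow> real) \<Rightarrow> 'a \<Rightarrow> 'a" where
  "model_minimizer p L P xt = (SOME y. is_arg_min (reg_taylor p L P xt) (\<lambda>_. True) y)"

definition step_ratio :: "nat \<Rightarrow> real \<Rightarrow> real \<Rightarrow> real \<Rightarrow> real" where
  "step_ratio p L lam r = lam * (L * r ^ (p - 1) / fact (p - 1))"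

text \<open>The value returned at depth \<open>0\<close> is irrelevant: that leaf is never reached.\<close>

primrec bisection ::
  "nat \<Rightarrow> real \<Rightarrow> real \<Rightarrow> 'a::euclidean_space \<Rightarrow> 'a \<Rightarrow> nat \<Rightarrow> real \<Rightarrow> real \<Rightarrow> 'a taylor_procedure" where
  "bisection p L A x y 0 lo hi = Return (Approx 0)"
| "bisection p L A x y (Suc n) lo hi =
    (let lam = (lo + hi) / 2; xt = extrapolation A x y lam in
     Query xt (\<lambda>P. let y' = model_minimizer p L P xt; eta = step_ratio p L lam (norm (y' - xt)) in
       if eta < 1 / 2 then bisection p L A x y n lam hi
       else if eta \<le> real p / (real p + 1) then Return (Iterate lam y')
       else bisection p L A x y n lo lam))"

text \<open>The query at the upper end either certifies accuracy or, together with the value 0 of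
  the ratio at \<open>lam = 0\<close>, brackets the target interval.\<close>

definition bracketing_search ::
  "nat \<Rightarrow> real \<Rightarrow> real \<Rightarrow> nat \<Rightarrow> real \<Rightarrow> 'a::euclidean_space \<Rightarrow> 'a \<Rightarrow> 'a taylor_procedure" where
  "bracketing_search p L lam n A x y =
    (let xt = extrapolation A x y lam in
     Query xt (\<lambda>P. let y' = model_minimizer p L P xt in
       if step_ratio p L lam (norm (y' - xt)) \<le> real p / (real p + 1) then Return (Approx y')
       else bisection p L A x y n 0 lam))"

section \<open>Correctness of the search\<close>

context convex_lipschitz_function
begin

lemma model_minimizer: "is_arg_min (model x) (\<lambda>_. True) (model_minimizer p L (taylor p f x) x)"
  unfolding model_minimizer_def using model_arg_min_exists by (rule someI_ex)

definition displacement :: "'a \<Rightarrow> real" where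
  "displacement x = norm (model_minimizer p L (taylor p f x) x - x)"

definition ratio_at :: "real \<Rightarrow> 'a \<Rightarrow> 'a \<Rightarrow> real \<Rightarrow> real" where
  "ratio_at A x y lam = step_ratio p L lam (displacement (extrapolation A x y lam))"

text \<open>A Lipschitz constant of \<open>ratio_at\<close> in \<open>lam\<close>. The displacement
  is at most 3 times the distance of the extrapolated point from \<open>xs\<close>, itself at most
  \<open>3 * norm xs\<close>; hence the 9.\<close>

definition ratio_lip :: real where
  "ratio_lip = L / fact (p - 1) * ((9 * norm xs) ^ (p - 1) * (1 + real (p - 1) * lip_const))"

lemma lip_const_nonneg: "0 \<le> lip_const"
  by (simp add: lip_const_def)

text \<open>The extrapolated point alone is not Lipschitz in \<open>lam\<close> near \<open>0\<close>, but \<open>lam\<close> times its variation is.\<close>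

lemma ratio_at_lipschitz:
  assumes p: "2 \<le> p" and A: "0 \<le> A" and x: "norm (x - xs) \<le> norm xs" and y: "norm (y - xs) \<le> 3 * norm xs"
    and lam: "0 \<le> lam1" "lam1 < lam2"
  shows "ratio_at A x y lam2 - ratio_at A x y lam1 \<le> ratio_lip * (lam2 - lam1)"
proof -
  define R where "R = norm xs"
  have R: "0 \<le> R" by (simp add: R_def)
  define xt where "xt = extrapolation A x y"
  define r1 r2 where r: "r1 = displacement (xt lam1)" "r2 = displacement (xt lam2)"
  have nn: "0 \<le> r1" "0 \<le> r2" by (simp_all add: r displacement_def)
  have le: "displacement (xt l) \<le> 9 * R" if "0 < l" for l
  proof -
    have "norm (xt l - xs) \<le> 3 * R"
      unfolding xt_def R_def using A that x y norm_ge_zero[of xs] by (intro norm_extrapolation_le) linarith+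
    then show ?thesis using arg_min_displacement[OF model_minimizer, of "xt l"] by (simp add: displacement_def)
  qed
  have r2: "r2 \<le> 9 * R" using le[of lam2] lam by (simp add: r)
  \<comment> \<open>The triangle inequality gives \<open>4 * R\<close>; it is relaxed to
    \<open>9 * R\<close> to merge with the powers of \<open>9 * R\<close> below.\<close>
  have yx: "norm (y - x) \<le> 9 * R"
    using norm_triangle_ineq4[of "y - xs" "x - xs"] x y R unfolding R_def[symmetric] by simp
  \<comment> \<open>One half of a discrete product rule: the change of
    \<open>lam * r ^ (p - 1)\<close> is this plus
    \<open>(lam2 - lam1) * r2 ^ (p - 1)\<close>.\<close>
  have "lam1 * (r2 ^ (p - 1) - r1 ^ (p - 1)) \<le> (lam2 - lam1) * (real (p - 1) * (9 * R) ^ (p - 1) * lip_const)"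
  proof (cases "lam1 = 0")
    case True
    then show ?thesis using lam R lip_const_nonneg by simp
  next
    case False
    then have l1: "0 < lam1" using lam by simp
    then have r1: "r1 \<le> 9 * R" using le by (simp add: r)
    have "\<bar>r2 - r1\<bar> \<le> lip_const * norm (xt lam2 - xt lam1)"
    proof (cases "xt lam1 = xt lam2")
      case False
      from displacement_lipschitz[OF p model_minimizer model_minimizer this] show ?thesis
        by (simp add: r displacement_def abs_minus_commute)
    qed (simp add: r)
    moreover have "\<bar>r2 ^ (p - 1) - r1 ^ (p - 1)\<bar> \<le> real (p - 1) * (9 * R) ^ (p - 1 - 1) * \<bar>r2 - r1\<bar>"
      using nn r1 r2 by (intro abs_power_diff_le) auto
    ultimately have "r2 ^ (p - 1) - r1 ^ (p - 1) \<le> real (p - 1) * (9 * R) ^ (p - 1 - 1) * (lip_const * norm (xt lam2 - xt lam1))"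
      using R by (meson abs_le_D1 mult_left_mono mult_nonneg_nonneg of_nat_0_le_iff order_trans zero_le_power zero_le_numeral)
    then have "lam1 * (r2 ^ (p - 1) - r1 ^ (p - 1)) \<le> lam1 * (real (p - 1) * (9 * R) ^ (p - 1 - 1) * (lip_const * norm (xt lam2 - xt lam1)))"
      using l1 by (intro mult_left_mono) auto
    also have "\<dots> = real (p - 1) * (9 * R) ^ (p - 1 - 1) * lip_const * (lam1 * norm (xt lam2 - xt lam1))"
      by (simp only: mult_ac)
    also have "\<dots> \<le> real (p - 1) * (9 * R) ^ (p - 1 - 1) * lip_const * ((lam2 - lam1) * norm (y - x))"
      unfolding xt_def using R lip_const_nonneg l1 lam A by (intro mult_left_mono extrapolation_lipschitz) auto
    also have "\<dots> \<le> real (p - 1) * (9 * R) ^ (p - 1 - 1) * lip_const * ((lam2 - lam1) * (9 * R))"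
      using R lip_const_nonneg lam yx by (intro mult_left_mono) auto
    also have "\<dots> = (lam2 - lam1) * (real (p - 1) * ((9 * R) ^ (p - 1 - 1) * (9 * R)) * lip_const)"
      by (simp only: mult_ac)
    also have "(9 * R) ^ (p - 1 - 1) * (9 * R) = (9 * R) ^ (p - 1)"
      using p by (intro power_minus_mult) simp
    finally show ?thesis .
  qed
  moreover have "(lam2 - lam1) * r2 ^ (p - 1) \<le> (lam2 - lam1) * (9 * R) ^ (p - 1)"
    using lam nn r2 by (intro mult_left_mono power_mono) auto
  ultimately have "(lam2 - lam1) * r2 ^ (p - 1) + lam1 * (r2 ^ (p - 1) - r1 ^ (p - 1))
     \<le> (lam2 - lam1) * ((9 * R) ^ (p - 1) * (1 + real (p - 1) * lip_const))"
    by (simp add: algebra_simps)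
  then have "L / fact (p - 1) * ((lam2 - lam1) * r2 ^ (p - 1) + lam1 * (r2 ^ (p - 1) - r1 ^ (p - 1)))
     \<le> L / fact (p - 1) * ((lam2 - lam1) * ((9 * R) ^ (p - 1) * (1 + real (p - 1) * lip_const)))"
    using L0 by (intro mult_left_mono) auto
  moreover have "ratio_at A x y lam2 - ratio_at A x y lam1 = L / fact (p - 1) * ((lam2 - lam1) * r2 ^ (p - 1) + lam1 * (r2 ^ (p - 1) - r1 ^ (p - 1)))"
    by (simp add: ratio_at_def step_ratio_def r xt_def right_diff_distrib left_diff_distrib diff_divide_distrib mult_ac)
  ultimately show ?thesis
    by (simp add: ratio_lip_def R_def mult_ac)
qed

lemma atd_pairI:
  assumes "0 < lam" "1 / 2 \<le> ratio_at A x y lam" "ratio_at A x y lam \<le> real p / (real p + 1)"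
  shows "atd_pair p L f A x y lam (model_minimizer p L (taylor p f (extrapolation A x y lam)) (extrapolation A x y lam))"
  using assms model_minimizer unfolding atd_pair_def Let_def ratio_at_def step_ratio_def displacement_def reg_taylor_eq by blast

text \<open>Failure leaves a bracket shortened \<open>n\<close> times, across which the ratio jumps
  over the whole target interval; continuity enters only when this alternative is refuted.\<close>

lemma bisection_correct:
  assumes "0 \<le> lo" "lo < hi" "ratio_at A x y lo < 1 / 2" "real p / (real p + 1) < ratio_at A x y hi"
  shows "calls (taylor p f) (bisection p L A x y n lo hi) \<le> n \<and>
     ((\<exists>lam y'. result (taylor p f) (bisection p L A x y n lo hi) = Iterate lam y' \<and> atd_pair p L f A x y lam y') \<or>
      (\<exists>lo' hi'. 0 \<le> lo' \<and> lo' < hi' \<and> hi' - lo' = (hi - lo) / 2 ^ n \<and>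
        ratio_at A x y lo' < 1 / 2 \<and> real p / (real p + 1) < ratio_at A x y hi'))"
  using assms
proof (induction n arbitrary: lo hi)
  case 0
  then show ?case by auto
next
  case (Suc n)
  define lam where "lam = (lo + hi) / 2"
  have lam: "0 < lam" "lo < lam" "lam < hi" using Suc.prems by (auto simp: lam_def)
  have len: "(hi - lam) / 2 ^ n = (hi - lo) / 2 ^ Suc n" "(lam - lo) / 2 ^ n = (hi - lo) / 2 ^ Suc n"
    by (auto simp: lam_def field_simps)
  define xt where "xt = extrapolation A x y lam"
  define y' where "y' = model_minimizer p L (taylor p f xt) xt"
  have eta: "step_ratio p L lam (norm (y' - xt)) = ratio_at A x y lam"
    by (simp add: ratio_at_def displacement_def y'_def xt_def)
  define tree where "tree = (if ratio_at A x y lam < 1 / 2 then bisection p L A x y n lam hi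
       else if ratio_at A x y lam \<le> real p / (real p + 1) then Return (Iterate lam y')
       else bisection p L A x y n lo lam)"
  have run: "calls (taylor p f) (bisection p L A x y (Suc n) lo hi) = Suc (calls (taylor p f) tree)"
    "result (taylor p f) (bisection p L A x y (Suc n) lo hi) = result (taylor p f) tree"
    by (simp_all add: Let_def lam_def[symmetric] xt_def[symmetric] y'_def[symmetric] eta tree_def)
  consider "ratio_at A x y lam < 1 / 2" | "1 / 2 \<le> ratio_at A x y lam" "ratio_at A x y lam \<le> real p / (real p + 1)"
    | "1 / 2 \<le> ratio_at A x y lam" "real p / (real p + 1) < ratio_at A x y lam" by linarith
  then show ?case
  proof cases
    case 1
    then show ?thesis
      using Suc.IH[of lam hi] Suc.prems lam unfolding run len by (simp add: tree_def)
  next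
    case 2
    then show ?thesis
      using atd_pairI[of lam A x y] lam unfolding run by (simp add: tree_def y'_def xt_def)
  next
    case 3
    then show ?thesis
      using Suc.IH[of lo lam] Suc.prems lam unfolding run len by (simp add: tree_def)
  qed
qed

definition step_goal :: "real \<Rightarrow> real \<Rightarrow> 'a \<Rightarrow> 'a \<Rightarrow> 'a outcome \<Rightarrow> bool" where
  "step_goal \<epsilon> A x y out = (case out of Approx z \<Rightarrow> f z - f xs \<le> \<epsilon> | Iterate lam' y' \<Rightarrow> atd_pair p L f A x y lam' y')"

text \<open>For \<open>p \<ge> 2\<close> the target interval has length at least 1/6. The hypothesis
  on \<open>n\<close> lets the ratio vary by at most 1/6 over a final bracket, so no bracket can
  survive.\<close>

lemma bracketing_search_correct:
  assumes p: "2 \<le> p" and run: "atd p L f k A x y" and R: "0 < norm xs" and \<epsilon>: "0 < \<epsilon>"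
    and n: "ratio_lip * ((norm xs)\<^sup>2 / (2 * \<epsilon>)) * 6 \<le> 2 ^ n"
  defines "lam \<equiv> (norm xs)\<^sup>2 / (2 * \<epsilon>)"
  shows "calls (taylor p f) (bracketing_search p L lam n A x y) \<le> Suc n"
    and "step_goal \<epsilon> A x y (result (taylor p f) (bracketing_search p L lam n A x y))"
proof -
  have lam: "0 < lam" using R \<epsilon> by (simp add: lam_def)
  have A: "0 \<le> A" and pot: "A * (f y - f xs) + (norm (x - xs))\<^sup>2 / 2 \<le> (norm xs)\<^sup>2 / 2"
    and y: "norm (y - xs) \<le> 3 * norm xs" using atd_invariant[OF run] by auto
  have x: "norm (x - xs) \<le> norm xs"
  proof -
    have "0 \<le> A * (f y - f xs)" using f_min A by simp
    then have "(norm (x - xs))\<^sup>2 \<le> (norm xs)\<^sup>2" using pot by linarith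
    then show ?thesis by (rule power2_le_imp_le) simp
  qed
  define xt where "xt = extrapolation A x y lam"
  define y' where "y' = model_minimizer p L (taylor p f xt) xt"
  have eta: "step_ratio p L lam (norm (y' - xt)) = ratio_at A x y lam"
    by (simp add: ratio_at_def displacement_def y'_def xt_def)
  define tree where "tree = (if ratio_at A x y lam \<le> real p / (real p + 1) then Return (Approx y')
       else bisection p L A x y n 0 lam)"
  have tree: "calls (taylor p f) (bracketing_search p L lam n A x y) = Suc (calls (taylor p f) tree)"
    "result (taylor p f) (bracketing_search p L lam n A x y) = result (taylor p f) tree"
    by (simp_all add: bracketing_search_def Let_def xt_def[symmetric] y'_def[symmetric] eta tree_def)
  have "calls (taylor p f) tree \<le> n \<and> step_goal \<epsilon> A x y (result (taylor p f) tree)"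
  proof (cases "ratio_at A x y lam \<le> real p / (real p + 1)")
    case True
    obtain g where g: "GDERIV f y' :> g" using gradient_exists by blast
    define a where "a = step_size lam A"
    \<comment> \<open>\<open>A + a\<close> is at least \<open>lam\<close>, and \<open>lam\<close> is
      the value for which the potential bound \<open>(norm xs)\<^sup>2 / (2 * lam)\<close> equals
      \<open>\<epsilon>\<close>.\<close>
    have Aa: "lam \<le> A + a" using step_size_props(1)[OF lam A] A by (simp add: a_def)
    define eta' where "eta' = ratio_at A x y lam"
    have eta'1: "0 \<le> eta'" "eta' \<le> 1"
    proof -
      show "0 \<le> eta'" using lam L0 by (simp add: eta'_def ratio_at_def step_ratio_def displacement_def)
      show "eta' \<le> 1" using True unfolding eta'_def by (rule order_trans) simp
    qed
    have eta': "eta' = lam * (L * norm (y' - xt) ^ (p - 1) / fact (p - 1))"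
      unfolding eta'_def eta[symmetric] step_ratio_def ..
    have ps: "(A + a) * (f y' - f xs) + (norm (x - a *\<^sub>R g - xs))\<^sup>2 / 2
         + (1 - (1 - eta')\<^sup>2) * ((A + a) / lam * (norm (y' - xt))\<^sup>2) / 2
       \<le> A * (f y - f xs) + (norm (x - xs))\<^sup>2 / 2"
      by (rule potential_step[OF lam A xt_def a_def _ g eta'])
        (use True model_minimizer in \<open>auto simp: y'_def eta'_def\<close>)
    define X where "X = (1 - (1 - eta')\<^sup>2) * ((A + a) / lam * (norm (y' - xt))\<^sup>2) / 2"
    have "(1 - eta')\<^sup>2 \<le> 1" using eta'1 by (simp add: power_le_one)
    then have "0 \<le> X" using lam Aa by (simp add: X_def)
    then have "(A + a) * (f y' - f xs) \<le> (norm xs)\<^sup>2 / 2"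
      using ps pot zero_le_power2[of "norm (x - a *\<^sub>R g - xs)"] unfolding X_def[symmetric] by linarith
    moreover have "lam * (f y' - f xs) \<le> (A + a) * (f y' - f xs)"
      using Aa f_min by (intro mult_right_mono) auto
    ultimately have "lam * (f y' - f xs) \<le> (norm xs)\<^sup>2 / 2" by linarith
    then have "(f y' - f xs) * lam \<le> \<epsilon> * lam" using R \<epsilon> by (simp add: lam_def mult_ac)
    then have "f y' - f xs \<le> \<epsilon>" using lam by (rule mult_right_le_imp_le)
    then show ?thesis using True by (simp add: tree_def step_goal_def)
  next
    case False
    \<comment> \<open>The factor \<open>lam\<close> makes the ratio vanish, whatever point the
      extrapolation returns at 0.\<close>
    have "ratio_at A x y 0 < 1 / 2" by (simp add: ratio_at_def step_ratio_def)
    from bisection_correct[OF order_refl lam this, of n] False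
    have b: "calls (taylor p f) tree \<le> n"
     "(\<exists>lam y'. result (taylor p f) tree = Iterate lam y' \<and> atd_pair p L f A x y lam y') \<or>
      (\<exists>lo' hi'. 0 \<le> lo' \<and> lo' < hi' \<and> hi' - lo' = (lam - 0) / 2 ^ n \<and>
        ratio_at A x y lo' < 1 / 2 \<and> real p / (real p + 1) < ratio_at A x y hi')"
      by (auto simp: tree_def)
    have "\<not> (0 \<le> lo' \<and> lo' < hi' \<and> hi' - lo' = (lam - 0) / 2 ^ n \<and>
        ratio_at A x y lo' < 1 / 2 \<and> real p / (real p + 1) < ratio_at A x y hi')" for lo' hi'
    proof
      assume *: "0 \<le> lo' \<and> lo' < hi' \<and> hi' - lo' = (lam - 0) / 2 ^ n \<and>
        ratio_at A x y lo' < 1 / 2 \<and> real p / (real p + 1) < ratio_at A x y hi'"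
      then have "ratio_at A x y hi' - ratio_at A x y lo' \<le> ratio_lip * (lam / 2 ^ n)"
        using ratio_at_lipschitz[OF p A x y, of lo' hi'] by simp
      also have "\<dots> \<le> 1 / 6" using n unfolding lam_def[symmetric] by (simp add: divide_le_eq)
      also have "1 / 6 \<le> real p / (real p + 1) - 1 / 2" using p by (simp add: field_simps)
      finally show False using * by linarith
    qed
    then show ?thesis using b by (auto simp: step_goal_def)
  qed
  then show "calls (taylor p f) (bracketing_search p L lam n A x y) \<le> Suc n"
    and "step_goal \<epsilon> A x y (result (taylor p f) (bracketing_search p L lam n A x y))"
    unfolding tree by auto
qed

section \<open>Constants and the query budget\<close>

text \<open>Every numeral is absorbed into powers of \<open>p\<close>, using
  \<open>p \<ge> 2\<close>; the exponents total \<open>11 + 6 * (p - 1)\<close>. The 12 combines the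
  3 left in the depth condition with the 4 lost to rounding in
  \<open>search_depth_bounds\<close>.\<close>

lemma ratio_constant_le:
  assumes "2 \<le> p"
  shows "12 * (9 ^ (p - 1) * (1 + real (p - 1) * lip_const)) \<le> real p ^ (30 * p)"
proof -
  define q where "q = real p"
  have q: "2 \<le> q" using assms by (simp add: q_def)
  then have q1: "1 \<le> q" by simp
  define m where "m = p - 1"
  have mq: "real m \<le> q" by (simp add: m_def q_def)
  have two: "2 * x \<le> q * x" if "0 \<le> x" for x using q that by (intro mult_right_mono) auto
  have p2: "4 \<le> q ^ 2" using power_mono[OF q, of 2] by simp
  have p4: "16 \<le> q ^ 4" using power_mono[OF q, of 4] by simp
  have "2 * q * (q + 2) \<le> q ^ 4"
  proof -
    have "q + 2 \<le> q * q" using two[of q] q by linarith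
    then have "(2 * q) * (q + 2) \<le> (q * q) * (q * q)" using q by (intro mult_mono) auto
    then show ?thesis by (simp add: power4_eq_xxxx)
  qed
  moreover have "3 ^ m \<le> q ^ (2 * m)" using p2 power_mono[of 3 "q ^ 2" m] by (simp add: power_mult)
  ultimately have "2 * q * (q + 2) * 3 ^ m \<le> q ^ 4 * q ^ (2 * m)" by (intro mult_mono) auto
  moreover have "1 \<le> q ^ (4 + 2 * m)" using q1 by (rule one_le_power)
  ultimately have "lip_const \<le> 2 * q ^ (4 + 2 * m)"
    unfolding lip_const_def q_def[symmetric] m_def[symmetric] by (simp add: power_add)
  also have "\<dots> \<le> q ^ (5 + 2 * m)" using two[of "q ^ (4 + 2 * m)"] q by (simp add: power_add eval_nat_numeral)
  finally have "real m * lip_const \<le> q * q ^ (5 + 2 * m)"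
    using mq lip_const_nonneg by (intro mult_mono) auto
  moreover have "1 \<le> q ^ (6 + 2 * m)" using q1 by (rule one_le_power)
  ultimately have "1 + real m * lip_const \<le> 2 * q ^ (6 + 2 * m)" by (simp add: power_add eval_nat_numeral)
  also have "\<dots> \<le> q ^ (7 + 2 * m)" using two[of "q ^ (6 + 2 * m)"] q by (simp add: power_add eval_nat_numeral)
  finally have 1: "1 + real m * lip_const \<le> q ^ (7 + 2 * m)" .
  have 2: "9 ^ m \<le> q ^ (4 * m)" using p4 power_mono[of 9 "q ^ 4" m] by (simp add: power_mult)
  have "12 * (9 ^ m * (1 + real m * lip_const)) \<le> q ^ 4 * (q ^ (4 * m) * q ^ (7 + 2 * m))"
    using p4 1 2 q lip_const_nonneg by (intro mult_mono) auto
  also have "\<dots> = q ^ (11 + 6 * m)" by (simp flip: power_add)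
  also have "\<dots> \<le> q ^ (30 * p)" using q1 assms by (intro power_increasing) (auto simp: m_def)
  finally show ?thesis by (simp add: m_def q_def)
qed

lemma derivative_at_minimizer: "nabla f [h] xs = 0"
proof -
  have "((\<lambda>t. f (xs + t *\<^sub>R h)) has_real_derivative nabla f [h] (xs + 0 *\<^sub>R h)) (at 0)"
    using nabla_along_line[of "[]" xs h 0] p1 by simp
  from DERIV_local_min[OF this, of 1] show ?thesis using f_min by simp
qed

text \<open>Serves the case \<open>p = 1\<close> with budget 0, where the origin must be accurate
  without any query. The gradient vanishes at \<open>xs\<close>, so the expansion there is
  constant.\<close>

lemma value_at_0_le:
  assumes "p = 1"
  shows "f 0 - f xs \<le> L * (norm xs)\<^sup>2 / 2"
proof -
  have "taylor p f xs 0 = f xs"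
    using derivative_at_minimizer[of "- xs"] by (simp add: taylor_def assms)
  then have "\<bar>f 0 - f xs\<bar> \<le> L * (norm xs)\<^sup>2 / 2"
    using taylor_error[of 0 xs] by (simp add: assms power2_eq_square)
  then show ?thesis by linarith
qed

end

text \<open>The call budget rounded down, less the one query made before the bisection.\<close>

definition search_depth :: "nat \<Rightarrow> real \<Rightarrow> nat" where
  "search_depth p Q = nat \<lfloor>30 * real p * log 2 (real p) + log 2 (real_of_int \<lceil>Q\<rceil>)\<rfloor> - 1"

text \<open>Rounding and the reserved query lower the exponent by at most 2, hence the factor
  4.\<close>

lemma search_depth_bounds:
  assumes "2 \<le> p" "0 < Q"
  shows "real (Suc (search_depth p Q)) \<le> 30 * real p * log 2 (real p) + log 2 (real_of_int \<lceil>Q\<rceil>)"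
    and "real p ^ (30 * p) * Q \<le> 4 * 2 ^ search_depth p Q"
proof -
  define B where "B = 30 * real p * log 2 (real p) + log 2 (real_of_int \<lceil>Q\<rceil>)"
  define n where "n = search_depth p Q"
  have c: "1 \<le> \<lceil>Q\<rceil>" using assms(2) by linarith
  have "1 \<le> log 2 (real p)" using assms(1) by (simp add: le_log_iff)
  then have "60 * 1 \<le> (30 * real p) * log 2 (real p)" using assms(1) by (intro mult_mono) auto
  moreover have "0 \<le> log 2 (real_of_int \<lceil>Q\<rceil>)" using c by (simp add: zero_le_log_cancel_iff)
  ultimately have B: "60 \<le> B" by (simp add: B_def)
  \<comment> \<open>A budget of at least 60 makes both \<open>nat\<close> and the truncated
    subtraction exact.\<close>
  have nB: "real n = real_of_int \<lfloor>B\<rfloor> - 1"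
    using B by (simp add: n_def search_depth_def B_def[symmetric] of_nat_diff le_nat_iff le_floor_iff)
  show "real (Suc (search_depth p Q)) \<le> B"
    using nB unfolding n_def by simp
  have "B \<le> real n + 2" using nB by linarith
  then have "2 powr B \<le> 2 powr (real n + 2)" by (rule powr_mono) simp
  also have "\<dots> = 4 * 2 ^ n" by (simp add: powr_add powr_realpow)
  also have "2 powr B = real p ^ (30 * p) * real_of_int \<lceil>Q\<rceil>"
  proof -
    have "30 * real p * log 2 (real p) = log 2 (real p ^ (30 * p))"
      using assms(1) by (simp add: log_nat_power)
    then show ?thesis using assms(1) c by (simp add: B_def powr_add)
  qed
  finally have *: "real p ^ (30 * p) * real_of_int \<lceil>Q\<rceil> \<le> 4 * 2 ^ n" .
  have "real p ^ (30 * p) * Q \<le> real p ^ (30 * p) * real_of_int \<lceil>Q\<rceil>"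
    by (intro mult_left_mono) auto
  then show "real p ^ (30 * p) * Q \<le> 4 * 2 ^ search_depth p Q"
    using * unfolding n_def by linarith
qed

text \<open>\<open>R\<close> is the norm of the minimizer. At \<open>p = 1\<close> the ratio does
  not depend on the displacement, and \<open>lam = 1 / (2 * L)\<close> gives exactly 1/2; when
  \<open>Q \<le> 1\<close> as well, the budget is zero calls and the origin is returned.\<close>

definition atd_step_procedure :: "nat \<Rightarrow> real \<Rightarrow> real \<Rightarrow> real \<Rightarrow> real \<Rightarrow> 'a::euclidean_space \<Rightarrow> 'a \<Rightarrow> 'a taylor_procedure" where
  "atd_step_procedure p L \<epsilon> R A x y =
    (let Q = L * R ^ (p + 1) / \<epsilon> in
     if R = 0 \<or> (p = 1 \<and> Q \<le> 1) then Return (Approx 0)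
     else if p = 1 then
       (let lam = 1 / (2 * L); xt = extrapolation A x y lam in
        Query xt (\<lambda>P. Return (Iterate lam (model_minimizer p L P xt))))
     else bracketing_search p L (R\<^sup>2 / (2 * \<epsilon>)) (search_depth p Q) A x y)"

context convex_lipschitz_function
begin

lemma atd_step_procedure_correct:
  fixes \<epsilon> :: real
  assumes \<epsilon>: "0 < \<epsilon>" and run: "atd p L f k A x y"
  defines "proc \<equiv> atd_step_procedure p L \<epsilon> (norm xs) A x y"
  shows "real (calls (taylor p f) proc)
      \<le> 30 * real p * log 2 (real p) + log 2 (real_of_int \<lceil>L * norm xs ^ (p + 1) / \<epsilon>\<rceil>)"
    and "step_goal \<epsilon> A x y (result (taylor p f) proc)"
proof -
  define Q where "Q = L * norm xs ^ (p + 1) / \<epsilon>"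
  define B where "B = 30 * real p * log 2 (real p) + log 2 (real_of_int \<lceil>Q\<rceil>)"
  have Q0: "0 \<le> Q" using L0 \<epsilon> by (simp add: Q_def)
  have log_ceil: "0 \<le> log 2 (real_of_int \<lceil>Q\<rceil>)"
  proof (cases "Q = 0")
    case True
    then show ?thesis by (simp add: log_def) \<comment> \<open>\<open>log 2 0 = 0\<close> in HOL\<close>
  next
    case False
    then have "1 \<le> \<lceil>Q\<rceil>" using Q0 by linarith
    then show ?thesis by (simp add: zero_le_log_cancel_iff)
  qed
  have logp: "0 \<le> 30 * real p * log 2 (real p)"
    using p1 by (simp add: zero_le_log_cancel_iff)
  have "real (calls (taylor p f) proc) \<le> B \<and> step_goal \<epsilon> A x y (result (taylor p f) proc)"
  proof -
    consider "norm xs = 0" | "norm xs \<noteq> 0" "p = 1" "Q \<le> 1" | "norm xs \<noteq> 0" "p = 1" "1 < Q" | "norm xs \<noteq> 0" "2 \<le> p"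
      using p1 by linarith
    then show ?thesis
    proof cases
      case 1
      then have "proc = Return (Approx 0)" by (simp add: proc_def atd_step_procedure_def)
      moreover have "f 0 - f xs \<le> \<epsilon>" using 1 \<epsilon> by simp
      ultimately show ?thesis using log_ceil logp by (simp add: B_def step_goal_def)
    next
      case 2
      then have proc: "proc = Return (Approx 0)" by (simp add: proc_def atd_step_procedure_def Q_def)
      have "L * (norm xs)\<^sup>2 / 2 \<le> \<epsilon>" using 2(3) \<epsilon> L0 unfolding Q_def 2(2)
        by (simp add: divide_le_eq power2_eq_square)
      then have "f 0 - f xs \<le> \<epsilon>" using value_at_0_le[OF 2(2)] by linarith
      then show ?thesis using log_ceil logp by (simp add: proc B_def step_goal_def)
    next
      case 3
      define lam where "lam = 1 / (2 * L)"
      define xt where "xt = extrapolation A x y lam"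
      have "proc = Query xt (\<lambda>P. Return (Iterate lam (model_minimizer p L P xt)))"
        using 3 by (simp add: proc_def atd_step_procedure_def Q_def lam_def xt_def Let_def)
      moreover have "ratio_at A x y lam = 1 / 2"
        using 3 L0 unfolding ratio_at_def step_ratio_def lam_def by simp
      then have "atd_pair p L f A x y lam (model_minimizer p L (taylor p f xt) xt)"
        unfolding xt_def using 3 L0 by (intro atd_pairI) (simp_all add: lam_def)
      \<comment> \<open>\<open>1 < Q\<close> raises the ceiling to at least 2, so the budget covers
        the single query.\<close>
      moreover have "1 \<le> B"
      proof -
        have "2 \<le> \<lceil>Q\<rceil>" using 3 by linarith
        then have "log 2 2 \<le> log 2 (real_of_int \<lceil>Q\<rceil>)" by (subst log_le_cancel_iff) auto
        then show ?thesis using logp by (simp add: B_def)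
      qed
      ultimately show ?thesis by (simp add: step_goal_def)
    next
      case 4
      define n where "n = search_depth p Q"
      have proc: "proc = bracketing_search p L ((norm xs)\<^sup>2 / (2 * \<epsilon>)) n A x y"
        using 4 by (simp add: proc_def atd_step_procedure_def Q_def n_def Let_def)
      have "0 < Q" using 4 L0 \<epsilon> by (simp add: Q_def)
      note depth = search_depth_bounds[OF 4(2) this, folded n_def B_def]
      define E where "E = 9 ^ (p - 1) * (1 + real (p - 1) * lip_const)"
      have E0: "0 \<le> E" using lip_const_nonneg by (simp add: E_def)
      \<comment> \<open>The 3 is 6 halved by the denominator of \<open>lam\<close>; the powers of
        \<open>norm xs\<close> combine to the exponent \<open>p + 1\<close> of
        \<open>Q\<close>.\<close>
      have "ratio_lip * ((norm xs)\<^sup>2 / (2 * \<epsilon>)) * 6 = 3 * E * Q / fact (p - 1)"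
      proof -
        have "norm xs ^ (p + 1) = norm xs ^ (p - 1) * (norm xs)\<^sup>2" using 4 by (simp flip: power_add)
        then show ?thesis unfolding ratio_lip_def E_def Q_def using \<epsilon> by (simp add: power_mult_distrib)
      qed
      also have "\<dots> \<le> 3 * E * Q / 1"
        using E0 Q0 by (intro divide_left_mono) (auto simp: fact_ge_1)
      also have "\<dots> \<le> real p ^ (30 * p) * Q / 4"
        using mult_right_mono[OF ratio_constant_le[OF 4(2)] Q0] unfolding E_def by simp
      also have "\<dots> \<le> 2 ^ n" using depth(2) by simp
      finally have n: "ratio_lip * ((norm xs)\<^sup>2 / (2 * \<epsilon>)) * 6 \<le> 2 ^ n" .
      have "0 < norm xs" using 4 by simp
      note bs = bracketing_search_correct[OF 4(2) run this \<epsilon> n]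
      then have "real (calls (taylor p f) proc) \<le> real (Suc n)" unfolding proc by (simp only: of_nat_le_iff)
      then show ?thesis using bs(2) depth(1) unfolding proc by linarith
    qed
  qed
  then show "real (calls (taylor p f) proc) \<le> 30 * real p * log 2 (real p) + log 2 (real_of_int \<lceil>L * norm xs ^ (p + 1) / \<epsilon>\<rceil>)"
    "step_goal \<epsilon> A x y (result (taylor p f) proc)"
    by (simp_all add: B_def Q_def)
qed

end

section \<open>Assembly of the rate and the query bound\<close>

lemma convex_lipschitz_functionI:
  assumes "1 \<le> p" "0 < L" "convex_on UNIV f" "lipschitz_derivative p L f" "is_arg_min f (\<lambda>_. True) xs"
  shows "convex_lipschitz_function p f L xs"
  using assms by unfold_locales (auto simp: lipschitz_derivative_def)

theorem theorem1p1:
  fixes p :: nat and L :: real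
  assumes "1 \<le> p" and "0 < L"
  shows
    "(\<forall>(f :: real ^ 'd \<Rightarrow> real) xs.
        convex_on UNIV f \<longrightarrow> lipschitz_derivative p L f \<longrightarrow> is_arg_min f (\<lambda>_. True) xs \<longrightarrow>
        (\<forall>k\<ge>1. \<forall>A x y. atd p L f k A x y \<longrightarrow>
           f y - f xs
             \<le> atd_const p * L * norm xs ^ (p + 1) / real k powr ((3 * real p + 1) / 2)))
     \<and>
     (\<forall>\<epsilon>>0. \<forall>R\<ge>0.
        \<exists>alg :: nat \<Rightarrow> real \<Rightarrow> real ^ 'd \<Rightarrow> real ^ 'd \<Rightarrow> (real ^ 'd) taylor_procedure.
        \<forall>(f :: real ^ 'd \<Rightarrow> real) xs.
          convex_on UNIV f \<longrightarrow> lipschitz_derivative p L f \<longrightarrow> is_arg_min f (\<lambda>_. True) xs \<longrightarrow>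
          norm xs = R \<longrightarrow>
          (\<forall>k\<ge>1. \<forall>A x y. atd p L f (k - 1) A x y \<longrightarrow>
             real (calls (taylor p f) (alg k A x y))
               \<le> 30 * real p * log 2 (real p)
                 + log 2 (real_of_int \<lceil>L * norm xs ^ (p + 1) / \<epsilon>\<rceil>) \<and>
             (case result (taylor p f) (alg k A x y) of
                Approx z \<Rightarrow> f z - f xs \<le> \<epsilon>
              | Iterate lam' y' \<Rightarrow> atd_pair p L f A x y lam' y')))"
proof (intro conjI allI impI)
  fix f :: "real ^ 'd \<Rightarrow> real" and xs x y :: "real ^ 'd" and k :: nat and A :: real
  assume "convex_on UNIV f" "lipschitz_derivative p L f" "is_arg_min f (\<lambda>_. True) xs"
    and *: "1 \<le> k" "atd p L f k A x y"
  then interpret convex_lipschitz_function p f L xs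
    using assms by (intro convex_lipschitz_functionI)
  show "f y - f xs \<le> atd_const p * L * norm xs ^ (p + 1) / real k powr ((3 * real p + 1) / 2)"
    using * by (intro atd_rate)
next
  fix \<epsilon> R :: real
  assume \<epsilon>: "0 < \<epsilon>" and "0 \<le> R"
  show "\<exists>alg :: nat \<Rightarrow> real \<Rightarrow> real ^ 'd \<Rightarrow> real ^ 'd \<Rightarrow> (real ^ 'd) taylor_procedure.
        \<forall>(f :: real ^ 'd \<Rightarrow> real) xs.
          convex_on UNIV f \<longrightarrow> lipschitz_derivative p L f \<longrightarrow> is_arg_min f (\<lambda>_. True) xs \<longrightarrow>
          norm xs = R \<longrightarrow>
          (\<forall>k\<ge>1. \<forall>A x y. atd p L f (k - 1) A x y \<longrightarrow>
             real (calls (taylor p f) (alg k A x y))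
               \<le> 30 * real p * log 2 (real p)
                 + log 2 (real_of_int \<lceil>L * norm xs ^ (p + 1) / \<epsilon>\<rceil>) \<and>
             (case result (taylor p f) (alg k A x y) of
                Approx z \<Rightarrow> f z - f xs \<le> \<epsilon>
              | Iterate lam' y' \<Rightarrow> atd_pair p L f A x y lam' y'))"
  \<comment> \<open>The iteration number is ignored: the step depends only on the current
    \<open>A\<close>, \<open>x\<close>, \<open>y\<close> and on \<open>R\<close>, which is fixed
    before \<open>f\<close> and \<open>xs\<close>.\<close>
  proof (intro exI[of _ "\<lambda>k. atd_step_procedure p L \<epsilon> R"] allI impI)
    fix f :: "real ^ 'd \<Rightarrow> real" and xs x y :: "real ^ 'd" and k :: nat and A :: real
    assume "convex_on UNIV f" "lipschitz_derivative p L f" "is_arg_min f (\<lambda>_. True) xs"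
      and R: "norm xs = R" and run: "atd p L f (k - 1) A x y"
    then interpret convex_lipschitz_function p f L xs
      using assms by (intro convex_lipschitz_functionI)
    show "real (calls (taylor p f) (atd_step_procedure p L \<epsilon> R A x y))
          \<le> 30 * real p * log 2 (real p) + log 2 (real_of_int \<lceil>L * norm xs ^ (p + 1) / \<epsilon>\<rceil>) \<and>
        (case result (taylor p f) (atd_step_procedure p L \<epsilon> R A x y) of
           Approx z \<Rightarrow> f z - f xs \<le> \<epsilon> | Iterate lam' y' \<Rightarrow> atd_pair p L f A x y lam' y')"
      using atd_step_procedure_correct[OF \<epsilon> run] unfolding R step_goal_def by blast
  qed
qed

end
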